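(* Let $X$ be a metrizable Suslin space, $Y$ a separable Fréchet space, $\alpha$ a successor countable ordinal, and $f:X\to Y$ a function. Then $f$ is Baire-$\alpha$ if and only if there is a sequence $(G_n)_{n=1}^{\infty}$ of $\Sigma_\alpha$-strips in $X\times Y$ with $G_{n+1}\subseteq G_n$ for all $n$, such that (i) $\bigcap_{n=1}^{\infty}G_n=gr(f)$; (ii) $diam(G_n(x))\to 0$ as $n\to\infty$ for each $x\in X$; (iii) for each $n$ and each open subset $U\subseteq Y$, the projection of $(X\times U)\cap G_n$ to $X$ is in $\Sigma_\alpha$.
   Context: A Suslin space is a Hausdorff topological space that is a continuous image of a Polish space; $X$ is additionally assumed metrizable (with a fixed metric). A Fréchet space is a locally convex topological vector space that is complete with respect to a translation invariant metric; diameters in $Y$ are with respect to this metric. Borel classes: $\Sigma_1$ = open sets; for countable $\alpha\ge1$, $\Pi_\alpha$ = complements of $\Sigma_\alpha$ sets; for $\alpha>1$, $\Sigma_\alpha$ = countable unions of sets $A_i\in\Pi_{\alpha_i}$ with $\alpha_i<\alpha$. Baire-0 functions are the continuous functions; for $\alpha\ge 1$, a function is Baire-$\alpha$ if it is a pointwise limit of functions $f_n$ that are Baire-$\alpha_n$ with $\alpha_n<\alpha$. $gr(f)=\{(x,f(x)):x\in X\}$. For $G\subseteq X\times Y$, $G(x)=\{y:(x,y)\in G\}$. A $\Sigma_\alpha$-strip is a $\Sigma_\alpha$ set $S\subseteq X\times Y$ with $S(x)$ convex for each $x\in X$. *)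

theory Defs
  imports "HOL-Analysis.Analysis"
begin

text \<open>Countable ordinals are represented by well-orders on subsets of nat
  (their order types); the ordinal 0 is the empty well-order.\<close>

definition successor_ordinal :: "nat rel \<Rightarrow> bool" where
  "successor_ordinal r \<longleftrightarrow> Well_order r \<and> (\<exists>m\<in>Field r. \<forall>x\<in>Field r. (x, m) \<in> r)"

inductive Sigma_class :: "nat rel \<Rightarrow> 'a::topological_space set \<Rightarrow> bool" where
  Sigma_one: "Well_order r \<Longrightarrow> (\<exists>k. Field r = {k}) \<Longrightarrow> open A \<Longrightarrow> Sigma_class r A"
| Sigma_union: "Well_order r \<Longrightarrow> Field r \<noteq> {} \<Longrightarrow> \<not> (\<exists>k. Field r = {k}) \<Longrightarrow>
     (\<forall>i::nat. \<exists>s. (s, r) \<in> ordLess \<and> Field s \<noteq> {} \<and> Sigma_class s (- B i)) \<Longrightarrow>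
     Sigma_class r (\<Union>i. B i)"

definition Pi_class :: "nat rel \<Rightarrow> 'a::topological_space set \<Rightarrow> bool" where
  "Pi_class r A \<longleftrightarrow> Sigma_class r (- A)"

inductive Baire_class :: "nat rel \<Rightarrow> ('a::topological_space \<Rightarrow> 'b::topological_space) \<Rightarrow> bool" where
  Baire_zero: "Well_order r \<Longrightarrow> Field r = {} \<Longrightarrow> continuous_on UNIV f \<Longrightarrow> Baire_class r f"
| Baire_limit: "Well_order r \<Longrightarrow> Field r \<noteq> {} \<Longrightarrow>
     (\<forall>n::nat. \<exists>s. (s, r) \<in> ordLess \<and> Baire_class s (g n)) \<Longrightarrow>
     (\<forall>x. (\<lambda>n. g n x) \<longlonglongrightarrow> f x) \<Longrightarrow> Baire_class r f"

definition separable_Frechet :: "'b::{real_vector,metric_space} itself \<Rightarrow> bool" where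
  "separable_Frechet _ \<longleftrightarrow>
     (\<forall>x y z::'b. dist (x + z) (y + z) = dist x y) \<and>
     continuous_on UNIV (\<lambda>p::'b \<times> 'b. fst p + snd p) \<and>
     continuous_on UNIV (\<lambda>p::real \<times> 'b. fst p *\<^sub>R snd p) \<and>
     (\<forall>U::'b set. open U \<and> 0 \<in> U \<longrightarrow> (\<exists>V. open V \<and> convex V \<and> 0 \<in> V \<and> V \<subseteq> U)) \<and>
     complete (UNIV::'b set) \<and>
     (\<exists>D::'b set. countable D \<and> closure D = UNIV)"

definition graph :: "('a \<Rightarrow> 'b) \<Rightarrow> ('a \<times> 'b) set" where
  "graph f = {(x, f x) | x. True}"

definition slice :: "('a \<times> 'b) set \<Rightarrow> 'a \<Rightarrow> 'b set" where
  "slice G x = {y. (x, y) \<in> G}"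

definition Sigma_strip :: "nat rel \<Rightarrow> ('a::topological_space \<times> 'b::{real_vector,topological_space}) set \<Rightarrow> bool" where
  "Sigma_strip r S \<longleftrightarrow> Sigma_class r S \<and> (\<forall>x. convex (slice S x))"

end

(* A Baire function f of class r is a limit of functions g_m of lower class. The strip G_n consists of
   the points within a small convex neighbourhood of a rational convex combination of the g_m with
   m >= n. There are countably many such combinations, each of class below r, and preimages of open
   sets under functions of class below r are Sigma_r.

   Conversely, let r = p + 1. For a dense sequence (d_i), the sets of those x for which G_n(x) comes close
   to d_i form a Sigma_r cover of X. If p >= 1, write these sets as countable unions of Pi_p sets and send x to the
   d_i belonging to the first Pi_p set containing x: this is a function of class p. If p = 0, the cover
   is open and a partition of unity gives a continuous function; here convexity of the slices is
   used. Since the slices shrink, these functions converge to f. *)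

theory Submission
  imports Defs
begin

text \<open>The indices match because a function of class below \<open>r\<close> pulls open sets
  back to Sigma_r, while for a function of class \<open>r\<close> one only gets the next class; so
  the strips are built from the approximants and not from \<open>f\<close>. Convex slices force
  convex combinations; rational coefficients keep the union countable, and local convexity keeps
  every combination of late approximants close to the limit.

  In the converse the selected functions need a class below \<open>r\<close>. The Pi sets that make
  up a Sigma_r set may have classes cofinal in a limit ordinal; for a successor they all fit into
  class \<open>p\<close>. The delicate point is that the first match in a cover by Pi_p sets is of
  class \<open>p\<close> and not merely p + 1. This goes by induction on \<open>p\<close>: a Pi_p
  set is an intersection of sets of lower class, and the first matches in finite subintersections
  stabilise at each point. The induction starts with closed sets, where weights made from distances
  give continuous approximations.\<close>

unbundle cardinal_syntax
no_notation Set_Algebras.elt_set_eq (infix "=o" 50)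

section \<open>Well-orders as ordinals\<close>

text \<open>The conditions on \<open>Field r\<close> in the Borel and Baire classes separate the
  ordinals 0 and 1 from the others. Written as comparisons with this representative of 1, they can
  be handled by transitivity of the ordinal order.\<close>

abbreviation one_ord :: "nat rel" where
  "one_ord \<equiv> {(0, 0)}"

lemma Well_order_one: "Well_order one_ord"
  by (simp add: well_order_on_def linear_order_on_def partial_order_on_def preorder_on_def
      refl_on_def trans_def antisym_def total_on_def Field_def)

lemma ordIso_Field_bij: "r =o s \<Longrightarrow> \<exists>h. bij_betw h (Field r) (Field s)"
  by (auto simp: ordIso_def iso_def)

lemma ordIso_Field_empty: "r =o s \<Longrightarrow> Field r = {} \<longleftrightarrow> Field s = {}"
  by (metis bij_betw_empty1 bij_betw_empty2 ordIso_Field_bij)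

text \<open>A smaller ordinal is isomorphic to the segment below some element, and the only element
  of a one-point order has nothing below it.\<close>

lemma ordLess_singleton_Field:
  assumes "s <o r" "Field r = {k}"
  shows "Field s = {}"
proof -
  have wo: "Well_order r" "Well_order s"
    using assms(1) by (auto simp: ordLess_def)
  then obtain a where a: "a \<in> Field r" "s =o Restr r (underS r a)"
    using assms(1) ordLess_iff_ordIso_Restr by blast
  have "underS r a = {}"
    using a(1) assms(2) FieldI1[of _ a r] by (auto simp: underS_def)
  then have "Field (Restr r (underS r a)) = {}"
    by (auto simp: Field_def)
  then show ?thesis
    using a(2) ordIso_Field_empty by blast
qed

lemma one_ordLeq_iff: "one_ord \<le>o r \<longleftrightarrow> Well_order r \<and> Field r \<noteq> {}"
proof (intro iffI conjI notI)
  assume le: "one_ord \<le>o r"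
  then show "Well_order r"
    by (auto simp: ordLeq_def)
  assume e: "Field r = {}"
  from le obtain f where "embed one_ord r f"
    by (auto simp: ordLeq_def)
  then have "f ` Field one_ord \<subseteq> Field r"
    using Well_order_one embed_Field by blast
  with e show False
    by (simp add: Field_def)
next
  assume "Well_order r \<and> Field r \<noteq> {}"
  then have wo: "Well_order r" and ne: "Field r \<noteq> {}"
    by auto
  have "\<not> r <o one_ord"
    using ordLess_singleton_Field[of r one_ord 0] ne by (auto simp: Field_def)
  then show "one_ord \<le>o r"
    using Well_order_one wo not_ordLess_iff_ordLeq by blast
qed

lemma ordIso_one_iff: "r =o one_ord \<longleftrightarrow> Well_order r \<and> (\<exists>k. Field r = {k})"
proof safe
  assume iso: "r =o one_ord"
  then show "Well_order r"
    by (auto simp: ordIso_def)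
  obtain h where "bij_betw h (Field r) (Field one_ord)"
    using ordIso_Field_bij[OF iso] by blast
  then have "card (Field r) = 1"
    by (simp add: bij_betw_same_card Field_def)
  then show "\<exists>k. Field r = {k}"
    by (auto simp: card_1_singleton_iff)
next
  fix k assume wo: "Well_order r" and k: "Field r = {k}"
  have "\<not> one_ord <o r"
    using ordLess_singleton_Field[OF _ k, of one_ord] by (auto simp: Field_def)
  then have "r \<le>o one_ord"
    using Well_order_one wo not_ordLess_iff_ordLeq by blast
  moreover have "one_ord \<le>o r"
    using wo k by (simp add: one_ordLeq_iff)
  ultimately show "r =o one_ord"
    by (simp add: ordIso_iff_ordLeq)
qed

lemma one_ordLess_iff:
  "one_ord <o r \<longleftrightarrow> Well_order r \<and> Field r \<noteq> {} \<and> \<not> (\<exists>k. Field r = {k})"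
proof -
  have "one_ord <o r \<longleftrightarrow> one_ord \<le>o r \<and> \<not> r =o one_ord"
    using ordLeq_iff_ordLess_or_ordIso[of one_ord r] ordIso_symmetric[of one_ord r]
      ordIso_symmetric[of r one_ord] not_ordLess_ordIso[of one_ord r] by argo
  then show ?thesis
    by (auto simp: one_ordLeq_iff ordIso_one_iff)
qed

lemma zero_ordLess_iff:
  assumes "Well_order r" "Field r = {}"
  shows "r <o s \<longleftrightarrow> one_ord \<le>o s"
proof
  assume lt: "r <o s"
  then have "Well_order s"
    by (simp add: ordLess_def)
  then obtain a where "a \<in> Field s"
    using lt assms(1) ordLess_iff_ordIso_Restr by blast
  then show "one_ord \<le>o s"
    using \<open>Well_order s\<close> by (auto simp: one_ordLeq_iff)
next
  assume le: "one_ord \<le>o s"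
  have "\<not> one_ord \<le>o r"
    using assms(2) by (simp add: one_ordLeq_iff)
  then have "\<not> s \<le>o r"
    using le ordLeq_transitive by blast
  moreover have "Well_order s"
    using le by (simp add: one_ordLeq_iff)
  ultimately show "r <o s"
    using assms(1) not_ordLeq_iff_ordLess by blast
qed

lemma ordLess_Well_order: "s <o r \<Longrightarrow> Well_order s" "s <o r \<Longrightarrow> Well_order r"
  by (auto simp: ordLess_def)

text \<open>Finitely many ordinals below \<open>r\<close> have a maximum, which is again below
  \<open>r\<close>; for infinitely many this fails at limit ordinals. Hence the approximations in
  \<open>first_match_Baire_class\<close> use finitely many sets per stage; there \<open>p\<close> is
  1 and makes the bound a valid index of a Borel class.\<close>

lemma finite_ordLess_bound:
  fixes p r :: "'a rel" and S :: "'a rel set"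
  assumes "finite S" "\<And>s. s \<in> S \<Longrightarrow> s <o r" "p <o r"
  shows "\<exists>q :: 'a rel. q <o r \<and> p \<le>o q \<and> (\<forall>s\<in>S. s \<le>o q)"
  using assms(1,2)
proof induction
  case empty
  then show ?case
    using assms(3) ordLess_Well_order(1) ordLeq_reflexive by blast
next
  case (insert a S)
  have "\<exists>q :: 'a rel. q <o r \<and> p \<le>o q \<and> (\<forall>s\<in>S. s \<le>o q)"
    by (rule insert.IH) (simp add: insert.prems)
  then obtain q :: "'a rel" where q: "q <o r" "p \<le>o q" "\<forall>s\<in>S. s \<le>o q"
    by (elim exE conjE)
  have a: "a <o r"
    using insert.prems[of a] by simp
  have wo: "Well_order a" "Well_order q"
    using ordLess_Well_order(1)[OF a] ordLess_Well_order(1)[OF q(1)] .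
  show ?case
  proof (cases "a \<le>o q")
    case True
    then show ?thesis
      using q by blast
  next
    case False
    then have "q \<le>o a"
      using wo ordLeq_total by blast
    then have "p \<le>o a" "\<forall>s\<in>S. s \<le>o a"
      using q(2,3) by (auto intro: ordLeq_transitive)
    then show ?thesis
      using a ordLeq_reflexive[OF wo(1)] by (intro exI[of _ a]) simp
  qed
qed

text \<open>The predecessor is the segment strictly below the greatest element \<open>m\<close>: any
  smaller ordinal is the segment below some \<open>a\<close>, and \<open>a\<close> is at most
  \<open>m\<close>.\<close>

lemma successor_ordinal_pred:
  assumes "successor_ordinal r"
  obtains p :: "nat rel" where "p <o r" "\<And>s :: nat rel. s <o r \<Longrightarrow> s \<le>o p"
proof -
  obtain m where wo: "Well_order r" and m: "m \<in> Field r" "\<And>x. x \<in> Field r \<Longrightarrow> (x, m) \<in> r"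
    using assms by (auto simp: successor_ordinal_def)
  have ord: "trans r" "antisym r"
    using wo by (auto simp: well_order_on_def linear_order_on_def partial_order_on_def preorder_on_def)
  have of: "wo_rel.ofilter r (underS r a)" for a
    using wo by (simp add: wo_rel.intro wo_rel.underS_ofilter)
  show ?thesis
  proof
    show "Restr r (underS r m) <o r"
      using wo m by (intro underS_Restr_ordLess) auto
    fix s :: "nat rel" assume s: "s <o r"
    then have "Well_order s"
      by (simp add: ordLess_def)
    then obtain a where a: "a \<in> Field r" "s =o Restr r (underS r a)"
      using s wo ordLess_iff_ordIso_Restr by blast
    have "underS r a \<subseteq> underS r m"
      using m(2)[OF a(1)] ord by (simp add: underS_incr)
    then have "Restr r (underS r a) \<le>o Restr r (underS r m)"
      using ofilter_subset_ordLeq[OF wo of of] by blast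
    then show "s \<le>o Restr r (underS r m)"
      using a(2) ordIso_ordLeq_trans by blast
  qed
qed

section \<open>Borel classes\<close>

lemma Sigma_class_iff:
  "Sigma_class r A \<longleftrightarrow> r =o one_ord \<and> open A \<or>
     one_ord <o r \<and> (\<exists>B. A = (\<Union>i. B i) \<and>
       (\<forall>i::nat. \<exists>s. s <o r \<and> one_ord \<le>o s \<and> Sigma_class s (- B i)))"
proof -
  have ne: "s <o r \<and> Field s \<noteq> {} \<and> P \<longleftrightarrow> s <o r \<and> one_ord \<le>o s \<and> P" for s :: "nat rel" and P
    using one_ordLeq_iff[of s] ordLess_Well_order(1)[of s r] by argo
  show ?thesis
  proof
    assume "Sigma_class r A"
    then show "r =o one_ord \<and> open A \<or>
     one_ord <o r \<and> (\<exists>B. A = (\<Union>i. B i) \<and>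
       (\<forall>i::nat. \<exists>s. s <o r \<and> one_ord \<le>o s \<and> Sigma_class s (- B i)))"
    proof cases
      case Sigma_one
      then show ?thesis
        by (simp add: ordIso_one_iff)
    next
      case (Sigma_union B)
      then show ?thesis
        unfolding ne one_ordLess_iff by (intro disjI2 conjI exI[of _ B]) simp_all
    qed
  next
    assume "r =o one_ord \<and> open A \<or>
     one_ord <o r \<and> (\<exists>B. A = (\<Union>i. B i) \<and>
       (\<forall>i::nat. \<exists>s. s <o r \<and> one_ord \<le>o s \<and> Sigma_class s (- B i)))"
    then show "Sigma_class r A"
    proof (elim disjE conjE exE)
      assume "r =o one_ord" "open A"
      then show ?thesis
        by (simp add: ordIso_one_iff Sigma_class.Sigma_one)
    next
      fix B assume "one_ord <o r" "A = (\<Union>i. B i)"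
        "\<forall>i::nat. \<exists>s. s <o r \<and> one_ord \<le>o s \<and> Sigma_class s (- B i)"
      then show ?thesis
        unfolding ne[symmetric] one_ordLess_iff by (simp add: Sigma_class.Sigma_union)
    qed
  qed
qed

lemma Sigma_class_cases:
  assumes "Sigma_class r A"
  obtains (one) "r =o one_ord" "open A"
  | (union) B where "one_ord <o r" "A = (\<Union>i. B i)"
      "\<And>i::nat. \<exists>s. s <o r \<and> one_ord \<le>o s \<and> Sigma_class s (- B i)"
  using assms unfolding Sigma_class_iff[of r A] by (elim disjE conjE exE) simp_all

lemma UN_prod_decode:
  "(\<Union>k. B (fst (prod_decode k)) (snd (prod_decode k))) = (\<Union>m. \<Union>n. B m n)"
proof -
  have "(\<Union>k. B (fst (prod_decode k)) (snd (prod_decode k))) = (\<Union>p\<in>range prod_decode. B (fst p) (snd p))"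
    by blast
  then show ?thesis
    by (auto simp: surj_prod_decode)
qed

lemma Sigma_class_ge_one: "Sigma_class r A \<Longrightarrow> one_ord \<le>o r"
  by (erule Sigma_class_cases) (simp_all add: ordIso_symmetric ordIso_imp_ordLeq ordLess_imp_ordLeq)

lemma Sigma_class_UnionI:
  assumes "one_ord <o r" "\<And>i::nat. \<exists>s. s <o r \<and> Sigma_class s (- B i)"
  shows "Sigma_class r (\<Union>i. B i)"
  unfolding Sigma_class_iff[of r]
proof (intro disjI2 conjI exI[of _ B] allI)
  show "\<exists>s. s <o r \<and> one_ord \<le>o s \<and> Sigma_class s (- B i)" for i
    using assms(2)[of i] Sigma_class_ge_one by (elim exE) auto
qed (simp_all add: assms(1))

text \<open>\<open>F n\<close> consists of the points at distance at least 1/(n+1) from the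
  complement. The nested interiors serve limits: a sequence with limit in \<open>F n\<close> is
  eventually in \<open>F (Suc n)\<close>.\<close>

lemma open_exhaustion:
  fixes U :: "'a::metric_space set"
  assumes "open U"
  obtains F :: "nat \<Rightarrow> 'a set"
  where "\<And>n. closed (F n)" "\<And>n. F n \<subseteq> interior (F (Suc n))" "U = (\<Union>n. F n)"
\<comment> \<open>\<open>infdist\<close> to the empty set is 0 by convention, which would make every
  level of the whole space empty.\<close>
proof (cases "U = UNIV")
  case True
  then show ?thesis
    by (intro that[of "\<lambda>_. UNIV"]) auto
next
  case False
  define F where "F = (\<lambda>n. {y. inverse (real (Suc n)) \<le> infdist y (- U)})"
  have cont: "continuous_on UNIV (\<lambda>y. infdist y (- U))"
    by (intro continuous_intros)
  show ?thesis
  proof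
    show "closed (F n)" for n
      unfolding F_def using cont by (intro closed_Collect_le continuous_intros)
    have "open {y. inverse (real (Suc (Suc n))) < infdist y (- U)}" for n
      using cont by (intro open_Collect_less continuous_intros)
    then have "{y. inverse (real (Suc (Suc n))) < infdist y (- U)} \<subseteq> interior (F (Suc n))" for n
      by (rule interior_maximal[rotated]) (auto simp: F_def)
    moreover have "F n \<subseteq> {y. inverse (real (Suc (Suc n))) < infdist y (- U)}" for n
      unfolding F_def by (auto elim: less_le_trans[rotated])
    ultimately show "F n \<subseteq> interior (F (Suc n))" for n
      by blast
    have U: "y \<in> U \<longleftrightarrow> 0 < infdist y (- U)" for y
    proof -
      have "y \<in> - U \<longleftrightarrow> infdist y (- U) = 0"
        using assms False by (intro in_closed_iff_infdist_zero) auto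
      then show ?thesis
        using infdist_nonneg[of y "- U"] by (simp add: less_le) argo
    qed
    have "0 < t \<longleftrightarrow> (\<exists>n. inverse (real (Suc n)) \<le> t)" for t :: real
    proof
      assume "0 < t"
      then show "\<exists>n. inverse (real (Suc n)) \<le> t"
        using reals_Archimedean[of t] by (auto intro: less_imp_le)
    next
      assume "\<exists>n. inverse (real (Suc n)) \<le> t"
      then obtain n where "inverse (real (Suc n)) \<le> t" ..
      moreover have "0 < inverse (real (Suc n))"
        by simp
      ultimately show "0 < t"
        by linarith
    qed
    then have "y \<in> U \<longleftrightarrow> (\<exists>n. y \<in> F n)" for y
      unfolding F_def mem_Collect_eq U .
    then show "U = (\<Union>n. F n)"
      by auto
  qed
qed

text \<open>Here the metric enters the hierarchy: an open set is a countable union of closed sets,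
  which are the Pi_1 sets.\<close>

lemma open_Sigma_class:
  fixes A :: "'a::metric_space set"
  assumes "open A" "one_ord \<le>o r"
  shows "Sigma_class r A"
proof (cases "one_ord <o r")
  case True
  obtain F where F: "\<And>n::nat. closed (F n)" "A = (\<Union>n. F n)"
    using open_exhaustion[OF assms(1)] by metis
  have "Sigma_class one_ord (- F n)" for n
    using F(1) Well_order_one by (subst Sigma_class_iff) (simp add: open_Compl ordIso_reflexive)
  then show ?thesis
    unfolding F(2) using True by (intro Sigma_class_UnionI) auto
next
  case False
  then have "r =o one_ord"
    using assms(2) ordLeq_iff_ordLess_or_ordIso ordIso_symmetric by blast
  then show ?thesis
    using assms(1) by (subst Sigma_class_iff) simp
qed

text \<open>A union that witnesses class \<open>s\<close> also witnesses class \<open>r\<close>;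
  only class 1 needs the metric. As \<open>\<le>o\<close> includes isomorphism, the class depends
  only on the order type.\<close>

lemma Sigma_class_mono:
  fixes A :: "'a::metric_space set"
  assumes "Sigma_class s A" "s \<le>o r"
  shows "Sigma_class r A"
  using assms(1)
proof (cases rule: Sigma_class_cases)
  case one
  then show ?thesis
    using ordLeq_transitive[OF Sigma_class_ge_one[OF assms(1)] assms(2)] by (simp add: open_Sigma_class)
next
  case (union B)
  show ?thesis
    unfolding union(2)
  proof (rule Sigma_class_UnionI)
    show "one_ord <o r"
      using ordLess_ordLeq_trans[OF union(1) assms(2)] .
    show "\<exists>t. t <o r \<and> Sigma_class t (- B i)" for i
      using union(3)[of i] ordLess_ordLeq_trans[OF _ assms(2)] by auto
  qed
qed

lemma Sigma_class_UN_nat: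
  fixes A :: "nat \<Rightarrow> 'a::metric_space set"
  assumes "\<And>n. Sigma_class r (A n)"
  shows "Sigma_class r (\<Union>n. A n)"
proof (cases "r =o one_ord")
  case True
  then have r: "\<not> one_ord <o r"
    using not_ordLess_ordIso ordIso_symmetric by blast
  have "open (A n)" for n
    using assms[of n] by (cases rule: Sigma_class_cases) (simp_all add: r)
  then show ?thesis
    using True by (subst Sigma_class_iff) (simp add: open_UN)
next
  case False
  have *: "one_ord <o r \<and> (\<exists>B. A n = (\<Union>i. B i) \<and> (\<forall>i::nat. \<exists>t. t <o r \<and> one_ord \<le>o t \<and> Sigma_class t (- B i)))"
    for n
    using assms[of n]
  proof (cases rule: Sigma_class_cases)
    case one
    then show ?thesis
      using False by simp
  next
    case (union B)
    then show ?thesis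
      by (intro conjI exI[of _ B]) simp_all
  qed
  then have "\<forall>n. \<exists>B. A n = (\<Union>i. B i) \<and> (\<forall>i::nat. \<exists>t. t <o r \<and> one_ord \<le>o t \<and> Sigma_class t (- B i))"
    by simp
  then obtain B where B: "\<And>n. A n = (\<Union>i. B n i)"
    "\<And>n i::nat. \<exists>t. t <o r \<and> one_ord \<le>o t \<and> Sigma_class t (- B n i)"
    by (auto dest!: choice)
  have "Sigma_class r (\<Union>k. B (fst (prod_decode k)) (snd (prod_decode k)))"
    using * B(2) by (intro Sigma_class_UnionI) (simp, metis)
  then show ?thesis
    by (simp add: UN_prod_decode B(1))
qed

lemma Sigma_class_empty: "one_ord \<le>o r \<Longrightarrow> Sigma_class r ({} :: 'a::metric_space set)"
  by (simp add: open_Sigma_class)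

lemma Sigma_class_UNION:
  fixes A :: "'i \<Rightarrow> 'a::metric_space set"
  assumes "countable I" "one_ord \<le>o r" "\<And>i. i \<in> I \<Longrightarrow> Sigma_class r (A i)"
  shows "Sigma_class r (\<Union>i\<in>I. A i)"
proof (cases "I = {}")
  case True
  then show ?thesis
    using assms(2) Sigma_class_empty by simp
next
  case False
  have "(\<Union>i\<in>I. A i) = (\<Union>n. A (from_nat_into I n))"
    using assms(1) False by (metis image_image range_from_nat_into)
  then show ?thesis
    using assms(3) False by (simp add: Sigma_class_UN_nat from_nat_into)
qed

section \<open>Countable unions of multiplicative sets\<close>

text \<open>For \<open>r\<close> of order type \<open>\<beta>\<close> this is the class \<open>\<Sigma>\<^bsub>\<beta>+1\<^esub>\<close>,
  expressed without constructing a well-order of type \<open>\<beta> + 1\<close>.\<close>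

definition pi_union :: "nat rel \<Rightarrow> 'a::topological_space set \<Rightarrow> bool" where
  "pi_union r A \<longleftrightarrow> (\<exists>B :: nat \<Rightarrow> _. (\<forall>i. Pi_class r (B i)) \<and> A = (\<Union>i. B i))"

lemma pi_union_Pi: "Pi_class r A \<Longrightarrow> pi_union r A"
  unfolding pi_union_def by (intro exI[of _ "\<lambda>_. A"]) auto

lemma Sigma_class_imp_pi_union:
  fixes A :: "'a::metric_space set"
  assumes "Sigma_class r A"
  shows "pi_union r A"
  using assms
proof (cases rule: Sigma_class_cases)
  case one
  obtain F where F: "\<And>n::nat. closed (F n)" "A = (\<Union>n. F n)"
    using open_exhaustion[OF \<open>open A\<close>] by metis
  then show ?thesis
    unfolding pi_union_def Pi_class_def using assms Sigma_class_ge_one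
    by (intro exI[of _ F]) (auto intro!: open_Sigma_class)
next
  case (union B)
  have "Sigma_class r (- B i)" for i
    using union(3)[of i] Sigma_class_mono ordLess_imp_ordLeq by blast
  then show ?thesis
    unfolding pi_union_def Pi_class_def using union(2) by blast
qed

lemma pi_union_UN_nat:
  fixes A :: "nat \<Rightarrow> 'a::topological_space set"
  assumes "\<And>n. pi_union r (A n)"
  shows "pi_union r (\<Union>n. A n)"
proof -
  obtain B where "\<And>n i. Pi_class r (B n i)" "\<And>n. A n = (\<Union>i::nat. B n i)"
    using assms unfolding pi_union_def by metis
  then show ?thesis
    unfolding pi_union_def
    by (intro exI[of _ "\<lambda>k. B (fst (prod_decode k)) (snd (prod_decode k))"]) (simp add: UN_prod_decode)
qed

text \<open>Distribute the intersection over both unions; Pi_r is closed under binary intersections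
  because Sigma_r is closed under unions.\<close>

lemma pi_union_Int:
  fixes A B :: "'a::metric_space set"
  assumes "pi_union r A" "pi_union r B"
  shows "pi_union r (A \<inter> B)"
proof -
  obtain C D :: "nat \<Rightarrow> 'a set" where CD: "\<And>i. Pi_class r (C i)" "A = (\<Union>i. C i)"
    "\<And>i. Pi_class r (D i)" "B = (\<Union>i. D i)"
    using assms unfolding pi_union_def by blast
  have one: "one_ord \<le>o r"
    using CD(1) Sigma_class_ge_one unfolding Pi_class_def by blast
  have "Pi_class r (C i \<inter> D j)" for i j
  proof -
    have "Sigma_class r (\<Union>S\<in>{- C i, - D j}. S)"
      using CD(1,3) one unfolding Pi_class_def by (intro Sigma_class_UNION) auto
    then show ?thesis
      by (simp add: Pi_class_def)
  qed
  moreover have "A \<inter> B = (\<Union>m. \<Union>n. C m \<inter> D n)"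
    unfolding CD by blast
  ultimately show ?thesis
    unfolding pi_union_def UN_prod_decode[symmetric]
    by (intro exI[of _ "\<lambda>k. C (fst (prod_decode k)) \<inter> D (snd (prod_decode k))"]) simp
qed

lemma pi_union_INT:
  fixes A :: "'i \<Rightarrow> 'a::metric_space set"
  assumes "finite I" "one_ord \<le>o r" "\<And>i. i \<in> I \<Longrightarrow> pi_union r (A i)"
  shows "pi_union r (\<Inter>i\<in>I. A i)"
  using assms(1,3)
proof induction
  case empty
  then show ?case
    using assms(2) by (simp add: open_Sigma_class Sigma_class_imp_pi_union)
next
  case (insert i I)
  then show ?case
    by (auto intro: pi_union_Int)
qed

text \<open>The varying classes in the definition of Sigma_r can all be raised to \<open>p\<close>.
  This connects \<open>pi_union\<close> with an actual successor.\<close>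

lemma pi_union_Sigma_succ:
  fixes A :: "'a::metric_space set"
  assumes "Sigma_class r A" "one_ord <o r" "\<And>s :: nat rel. s <o r \<Longrightarrow> s \<le>o p"
  shows "pi_union p A"
  using assms(1)
proof (cases rule: Sigma_class_cases)
  case one
  then show ?thesis
    using assms(2) not_ordLess_ordIso ordIso_symmetric by blast
next
  case (union B)
  have "Sigma_class p (- B i)" for i
    using union(3)[of i] Sigma_class_mono assms(3) by blast
  then show ?thesis
    unfolding pi_union_def Pi_class_def using union(2) by blast
qed

section \<open>Baire classes\<close>

lemma Baire_class_iff:
  "Baire_class r f \<longleftrightarrow> Well_order r \<and> Field r = {} \<and> continuous_on UNIV f \<or>
     one_ord \<le>o r \<and> (\<exists>g. (\<forall>n::nat. \<exists>s. s <o r \<and> Baire_class s (g n)) \<and>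
       (\<forall>x. (\<lambda>n. g n x) \<longlonglongrightarrow> f x))"
proof
  assume "Baire_class r f"
  then show "Well_order r \<and> Field r = {} \<and> continuous_on UNIV f \<or>
     one_ord \<le>o r \<and> (\<exists>g. (\<forall>n::nat. \<exists>s. s <o r \<and> Baire_class s (g n)) \<and>
       (\<forall>x. (\<lambda>n. g n x) \<longlonglongrightarrow> f x))"
  proof cases
    case Baire_zero
    then show ?thesis
      by simp
  next
    case (Baire_limit g)
    then show ?thesis
      unfolding one_ordLeq_iff by (intro disjI2 conjI exI[of _ g]) simp_all
  qed
next
  assume "Well_order r \<and> Field r = {} \<and> continuous_on UNIV f \<or>
     one_ord \<le>o r \<and> (\<exists>g. (\<forall>n::nat. \<exists>s. s <o r \<and> Baire_class s (g n)) \<and>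
       (\<forall>x. (\<lambda>n. g n x) \<longlonglongrightarrow> f x))"
  then show "Baire_class r f"
    unfolding one_ordLeq_iff
    by (elim disjE conjE exE) (simp_all add: Baire_class.Baire_zero Baire_class.Baire_limit)
qed

lemma Baire_class_cases:
  assumes "Baire_class r f"
  obtains (zero) "Well_order r" "Field r = {}" "continuous_on UNIV f"
  | (limit) g where "one_ord \<le>o r" "\<And>n::nat. \<exists>s. s <o r \<and> Baire_class s (g n)"
      "\<And>x. (\<lambda>n. g n x) \<longlonglongrightarrow> f x"
  using assms unfolding Baire_class_iff[of r f]
proof (elim disjE conjE exE)
  fix g assume "one_ord \<le>o r" "\<forall>n::nat. \<exists>s. s <o r \<and> Baire_class s (g n)"
    "\<forall>x. (\<lambda>n. g n x) \<longlonglongrightarrow> f x"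
  then show thesis
    by (intro limit[of g]) simp_all
qed (rule zero)

lemma Baire_class_limI:
  assumes "one_ord \<le>o r" "\<And>n::nat. \<exists>s. s <o r \<and> Baire_class s (g n)"
    "\<And>x. (\<lambda>n. g n x) \<longlonglongrightarrow> f x"
  shows "Baire_class r f"
  unfolding Baire_class_iff[of r f]
  by (intro disjI2 conjI exI[of _ g] allI) (simp_all add: assms)

lemma Baire_class_const_limI:
  assumes "s <o r" "Baire_class s f"
  shows "Baire_class r f"
proof (rule Baire_class_limI[where g = "\<lambda>_. f"])
  obtain a where "a \<in> Field r"
    using assms(1) ordLess_Well_order[OF assms(1)] ordLess_iff_ordIso_Restr[of r s] by blast
  then show "one_ord \<le>o r"
    using ordLess_Well_order[OF assms(1)] by (auto simp: one_ordLeq_iff)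
  show "\<exists>s. s <o r \<and> Baire_class s f"
    using assms by auto
qed simp

lemma Baire_class_mono:
  assumes "Baire_class s f" "s \<le>o r"
  shows "Baire_class r f"
proof (cases "s <o r")
  case True
  then show ?thesis
    using assms(1) by (rule Baire_class_const_limI)
next
  case False
  then have iso: "s =o r"
    using assms(2) ordLeq_iff_ordLess_or_ordIso by blast
  from assms(1) show ?thesis
  proof (cases rule: Baire_class_cases)
    case zero
    then have "Field r = {}" "Well_order r"
      using ordIso_Field_empty[OF iso] iso by (auto simp: ordIso_def)
    then show ?thesis
      using zero(3) by (simp add: Baire_zero)
  next
    case (limit g)
    show ?thesis
    proof (rule Baire_class_limI[OF _ _ limit(3)])
      show "one_ord \<le>o r"
        using ordLeq_transitive[OF limit(1) assms(2)] .
      show "\<exists>t. t <o r \<and> Baire_class t (g n)" for n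
        using limit(2)[of n] ordLess_ordLeq_trans[OF _ assms(2)] by auto
    qed
  qed
qed

lemma Baire_class_common:
  assumes "\<exists>t. t <o s \<and> Baire_class t h" "\<exists>t. t <o s \<and> Baire_class t k"
  obtains t :: "nat rel" where "t <o s" "Baire_class t h" "Baire_class t k"
proof -
  obtain t where t: "t <o s" "Baire_class t h"
    using assms(1) by auto
  obtain t' where t': "t' <o s" "Baire_class t' k"
    using assms(2) by auto
  have "t \<le>o t' \<or> t' \<le>o t"
    using ordLeq_total[OF ordLess_Well_order(1)[OF t(1)] ordLess_Well_order(1)[OF t'(1)]] .
  then show thesis
    using that[of t] that[of t'] t t' Baire_class_mono[OF t(2)] Baire_class_mono[OF t'(2)] by metis
qed

text \<open>Continuity of \<open>F\<close> lets each limit pass through. The map \<open>p\<close>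
  and the extra argument \<open>z\<close> are there for the function
  \<open>(x, y) \<mapsto> y - h x\<close> on the product, whose preimages make up the
  strips.\<close>

lemma Baire_class_compose:
  fixes F :: "'c::topological_space \<times> 'b::topological_space \<Rightarrow> 'd::topological_space"
    and h :: "'a::topological_space \<Rightarrow> 'b"
  assumes "Baire_class s h" "continuous_on UNIV p" "continuous_on UNIV F"
  shows "Baire_class s (\<lambda>z. F (z, h (p z)))"
  using assms(1)
proof induction
  case (Baire_zero r f)
  have "continuous_on UNIV (\<lambda>z. (z, f (p z)))"
    using continuous_on_compose2[OF Baire_zero(3) assms(2)] by (intro continuous_intros) auto
  then have "continuous_on UNIV (\<lambda>z. F (z, f (p z)))"
    using continuous_on_compose2[OF assms(3)] by fast
  then show ?case
    using Baire_zero by (simp add: Baire_class.Baire_zero)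
next
  case (Baire_limit r g f)
  show ?case
  proof (rule Baire_class_limI)
    show "one_ord \<le>o r"
      using Baire_limit.hyps by (simp add: one_ordLeq_iff)
    show "\<exists>s. s <o r \<and> Baire_class s (\<lambda>z. F (z, g n (p z)))" for n
      using Baire_limit.IH by auto
    show "(\<lambda>n. F (z, g n (p z))) \<longlonglongrightarrow> F (z, f (p z))" for z
    proof (rule continuous_on_tendsto_compose[OF assms(3)])
      show "(\<lambda>n. (z, g n (p z))) \<longlonglongrightarrow> (z, f (p z))"
        using Baire_limit.hyps(3) by (intro tendsto_intros) simp
    qed simp_all
  qed
qed

text \<open>Approximate \<open>h\<close> and \<open>k\<close> simultaneously. Their approximants may
  have different classes, and \<open>Baire_class_common\<close> raises both to one class below
  \<open>s\<close>; hence the induction is on the ordinal and not on a derivation.\<close>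

lemma Baire_class_binary:
  fixes F :: "'b::topological_space \<times> 'c::topological_space \<Rightarrow> 'd::topological_space"
    and h k :: "'a::topological_space \<Rightarrow> _"
  assumes F: "continuous_on UNIV F" and "Baire_class s h" "Baire_class s k"
  shows "Baire_class s (\<lambda>x. F (h x, k x))"
  using assms(2,3)
proof (induction s arbitrary: h k rule: wf_induct_rule[OF wf_ordLess])
  case (1 s)
  from 1(2) show ?case
  proof (cases rule: Baire_class_cases)
    case zero
    have "continuous_on UNIV k"
      using 1(3) zero(2) by (cases rule: Baire_class_cases) (simp_all add: one_ordLeq_iff)
    then have "continuous_on UNIV (\<lambda>x. (h x, k x))"
      using zero(3) by (intro continuous_intros)
    then have "continuous_on UNIV (\<lambda>x. F (h x, k x))"
      using continuous_on_compose2[OF F] by fast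
    then show ?thesis
      using zero by (simp add: Baire_class.Baire_zero)
  next
    case (limit g)
    from 1(3) obtain g' where g': "\<And>n::nat. \<exists>t. t <o s \<and> Baire_class t (g' n)"
        "\<And>x. (\<lambda>n. g' n x) \<longlonglongrightarrow> k x"
      using limit(1) by (cases rule: Baire_class_cases) (auto simp: one_ordLeq_iff)
    show ?thesis
    proof (rule Baire_class_limI[OF limit(1)])
      fix n
      obtain u where u: "u <o s" "Baire_class u (g n)" "Baire_class u (g' n)"
        by (rule Baire_class_common[OF limit(2) g'(1), of n n]) (rule that)
      then show "\<exists>t. t <o s \<and> Baire_class t (\<lambda>x. F (g n x, g' n x))"
        using 1(1)[OF u] by (intro exI[of _ u]) simp
    next
      show "(\<lambda>n. F (g n x, g' n x)) \<longlonglongrightarrow> F (h x, k x)" for x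
      proof (rule continuous_on_tendsto_compose[OF F])
        show "(\<lambda>n. (g n x, g' n x)) \<longlonglongrightarrow> (h x, k x)"
          using limit(3) g'(2) by (intro tendsto_intros)
      qed simp_all
    qed
  qed
qed

text \<open>\<open>f x\<close> lies in \<open>U\<close> iff, for some \<open>n\<close>, all late
  \<open>g m x\<close> lie in the closed set \<open>F n\<close>. For fixed \<open>n\<close> and
  starting index this is a Pi_s condition: its complement is a countable union of preimages of open
  sets under functions of class below \<open>s\<close>.\<close>

lemma Baire_class_vimage_open:
  fixes h :: "'a::metric_space \<Rightarrow> 'b::metric_space"
  assumes "Baire_class s h" "s <o r" "open U"
  shows "Sigma_class r (h -` U)"
  using assms
proof (induction arbitrary: r U)
  case (Baire_zero s f)
  then have "open (f -` U)"
    by (simp add: continuous_on_open_vimage)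
  then show ?case
    using zero_ordLess_iff[OF Baire_zero(1,2), of r] Baire_zero(4) by (simp add: open_Sigma_class)
next
  case (Baire_limit s g f)
  obtain F where F: "\<And>n::nat. closed (F n)" "\<And>n. F n \<subseteq> interior (F (Suc n))" "U = (\<Union>n. F n)"
    using open_exhaustion[OF Baire_limit.prems(2)] by metis
  have one: "one_ord \<le>o s"
    using Baire_limit.hyps(1,2) by (simp add: one_ordLeq_iff)
  define B where "B = (\<lambda>n N. \<Inter>m\<in>{N..}. g m -` F n)"
  have "Sigma_class s (- B n N)" for n N
  proof -
    have "Sigma_class s (g m -` (- F n))" for m
      using Baire_limit.IH F(1)[of n] by (metis open_Compl)
    then have "Sigma_class s (\<Union>m\<in>{N..}. g m -` (- F n))"
      using one by (intro Sigma_class_UNION) auto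
    moreover have "- B n N = (\<Union>m\<in>{N..}. g m -` (- F n))"
      by (auto simp: B_def)
    ultimately show ?thesis
      by simp
  qed
  then have "Sigma_class r (\<Union>k. B (fst (prod_decode k)) (snd (prod_decode k)))"
    using Baire_limit.prems(1) ordLeq_ordLess_trans[OF one Baire_limit.prems(1)]
    by (intro Sigma_class_UnionI) auto
  moreover have "f -` U = (\<Union>n. \<Union>N. B n N)"
  proof (intro subset_antisym subsetI)
    fix x assume "x \<in> f -` U"
    then obtain n where "f x \<in> interior (F (Suc n))"
      using F(2,3) by blast
    then have "\<forall>\<^sub>F m in sequentially. g m x \<in> interior (F (Suc n))"
      using Baire_limit.hyps(3) by (intro topological_tendstoD) auto
    then obtain N where "\<forall>m\<ge>N. g m x \<in> F (Suc n)"
      using interior_subset unfolding eventually_sequentially by blast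
    then have "x \<in> B (Suc n) N"
      by (simp add: B_def)
    then show "x \<in> (\<Union>n. \<Union>N. B n N)"
      by blast
  next
    fix x assume "x \<in> (\<Union>n. \<Union>N. B n N)"
    then obtain n N where "\<forall>m\<ge>N. g m x \<in> F n"
      by (auto simp: B_def)
    then have "\<forall>\<^sub>F m in sequentially. g m x \<in> F n"
      by (auto simp: eventually_sequentially)
    then have "f x \<in> F n"
      using Baire_limit.hyps(3) F(1) by (auto intro: Lim_in_closed_set)
    then show "x \<in> f -` U"
      using F(3) by auto
  qed
  ultimately show ?case
    by (simp add: UN_prod_decode)
qed

section \<open>Metric vector spaces\<close>

lemma sum_lessThan_eq:
  fixes F :: "nat \<Rightarrow> 'a::comm_monoid_add"
  assumes "\<And>i. n \<le> i \<Longrightarrow> F i = 0" "\<And>i. m \<le> i \<Longrightarrow> F i = 0"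
  shows "(\<Sum>i<n. F i) = (\<Sum>i<m. F i)"
  using assms by (intro sum.mono_neutral_cong) auto

text \<open>The sort of \<open>'b\<close> does not tie the metric to the vector operations, so
  translation and continuity rules have to come from the hypothesis on the type.\<close>

locale Frechet =
  fixes Y :: "'b::{real_vector,metric_space} itself"
  assumes Frechet: "separable_Frechet TYPE('b)"
begin

lemma dist_translate: "dist (x + z) (y + z) = dist x (y :: 'b)"
  using Frechet unfolding separable_Frechet_def by blast

lemma dist_diff: "dist x y = dist 0 (y - x :: 'b)"
  using dist_translate[of x "- x" y] by simp

lemma continuous_on_plus:
  fixes f g :: "'c::topological_space \<Rightarrow> 'b"
  assumes "continuous_on S f" "continuous_on S g"
  shows "continuous_on S (\<lambda>x. f x + g x)"
proof -
  have "continuous_on UNIV (\<lambda>p::'b \<times> 'b. fst p + snd p)"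
    using Frechet unfolding separable_Frechet_def by blast
  from continuous_on_compose2[OF this continuous_on_Pair[OF assms]] show ?thesis
    by simp
qed

lemma continuous_on_scale:
  fixes f :: "'c::topological_space \<Rightarrow> 'b"
  assumes "continuous_on S a" "continuous_on S f"
  shows "continuous_on S (\<lambda>x. a x *\<^sub>R f x)"
proof -
  have "continuous_on UNIV (\<lambda>p::real \<times> 'b. fst p *\<^sub>R snd p)"
    using Frechet unfolding separable_Frechet_def by blast
  from continuous_on_compose2[OF this continuous_on_Pair[OF assms]] show ?thesis
    by simp
qed

lemma continuous_on_minus:
  fixes f g :: "'c::topological_space \<Rightarrow> 'b"
  assumes "continuous_on S f" "continuous_on S g"
  shows "continuous_on S (\<lambda>x. f x - g x)"
  using continuous_on_plus[OF assms(1) continuous_on_scale[OF continuous_on_const assms(2), of "- 1"]]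
  by simp

lemma continuous_on_sum_scale:
  fixes v :: "'i \<Rightarrow> 'b" and a :: "'i \<Rightarrow> 'c::topological_space \<Rightarrow> real"
  assumes "\<And>i. i \<in> I \<Longrightarrow> continuous_on S (a i)"
  shows "continuous_on S (\<lambda>x. \<Sum>i\<in>I. a i x *\<^sub>R v i)"
  using assms
proof (induction I rule: infinite_finite_induct)
  case (insert i I)
  then show ?case
    by (simp add: continuous_on_plus continuous_on_scale continuous_on_const)
qed (simp_all add: continuous_on_const)

text \<open>Balls of a translation invariant metric need not be convex, so convex neighbourhoods
  inside balls replace them wherever combinations are formed.\<close>

lemma convex_neighbourhood:
  assumes "0 < e"
  obtains V :: "'b set" where "open V" "convex V" "0 \<in> V" "V \<subseteq> ball 0 e"
proof -
  have "\<forall>U :: 'b set. open U \<and> 0 \<in> U \<longrightarrow> (\<exists>V. open V \<and> convex V \<and> 0 \<in> V \<and> V \<subseteq> U)"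
    using Frechet unfolding separable_Frechet_def by blast
  moreover have "open (ball (0 :: 'b) e) \<and> 0 \<in> ball (0 :: 'b) e"
    using assms by simp
  ultimately show thesis
    using that by blast
qed

lemma dense_sequence:
  obtains d :: "nat \<Rightarrow> 'b" where "closure (range d) = UNIV"
proof -
  obtain D :: "'b set" where D: "countable D" "closure D = UNIV"
    using Frechet unfolding separable_Frechet_def by blast
  then have "D \<noteq> {}"
    by auto
  then show thesis
    using that[of "from_nat_into D"] D by (simp add: range_from_nat_into)
qed

section \<open>Selections of low Baire class\<close>

text \<open>For \<open>k > 0\<close>, \<open>\<phi> k m\<close> is a continuous stand-in for the
  indicator of \<open>C m\<close>: it is 1 on the set and 0 from distance 1/k on. Then
  \<open>w k m\<close> imitates "in \<open>C m\<close> and in no earlier set". At a fixed point the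
  finitely many earlier sets, being closed, have weight 0 for large \<open>k\<close>, so
  \<open>g k x\<close> is eventually constant.\<close>

lemma closed_first_match:
  fixes C :: "nat \<Rightarrow> 'a::metric_space set" and v :: "nat \<Rightarrow> 'b"
  assumes "\<And>m. closed (C m)" "(\<Union>m. C m) = UNIV"
  obtains g :: "nat \<Rightarrow> 'a \<Rightarrow> 'b" where "\<And>k. continuous_on UNIV (g k)"
    "\<And>x. (\<lambda>k. g k x) \<longlonglongrightarrow> v (LEAST m. x \<in> C m)"
proof -
  \<comment> \<open>Without the case distinction an empty \<open>C m\<close> would get weight 1
    everywhere, since \<open>infdist\<close> to it is 0.\<close>
  define \<phi> where "\<phi> = (\<lambda>k m x. if C m = {} then 0 else max 0 (1 - real k * infdist x (C m)))"
  define w where "w = (\<lambda>k m x. \<phi> k m x * (\<Prod>j<m. 1 - \<phi> k j x))"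
  define g where "g = (\<lambda>k x. \<Sum>m<k. w k m x *\<^sub>R v m)"
  have \<phi>: "continuous_on UNIV (\<phi> k m)" for k m
    unfolding \<phi>_def by (cases "C m = {}") (auto intro!: continuous_intros)
  have "continuous_on UNIV (w k m)" for k m
    unfolding w_def by (intro continuous_intros \<phi>)
  then have "continuous_on UNIV (g k)" for k
    unfolding g_def by (intro continuous_on_sum_scale)
  moreover have "(\<lambda>k. g k x) \<longlonglongrightarrow> v (LEAST m. x \<in> C m)" for x
  proof (rule tendsto_eventually)
    define m0 where "m0 = (LEAST m. x \<in> C m)"
    have "\<exists>m. x \<in> C m"
      using assms(2) by blast
    then have m0: "x \<in> C m0" "\<And>m. m < m0 \<Longrightarrow> x \<notin> C m"
      unfolding m0_def by (auto intro: LeastI dest: not_less_Least)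
    have one: "\<phi> k m0 x = 1" for k
      using m0(1) by (auto simp: \<phi>_def)
    have "\<forall>\<^sub>F k in sequentially. \<phi> k m x = 0" if "m < m0" for m
    proof (cases "C m = {}")
      case True
      then show ?thesis
        by (simp add: \<phi>_def)
    next
      case False
      have "infdist x (C m) \<noteq> 0"
        using in_closed_iff_infdist_zero[OF assms(1) False] m0(2)[OF that] by auto
      then have pos: "0 < infdist x (C m)"
        using infdist_nonneg[of x "C m"] by linarith
      obtain N where N: "1 / infdist x (C m) < real N"
        using reals_Archimedean2 by blast
      have "\<phi> k m x = 0" if "k \<ge> N" for k
      proof -
        have "1 / infdist x (C m) \<le> real k"
          using N that by linarith
        then have "1 \<le> real k * infdist x (C m)"
          using pos by (simp add: divide_le_eq)
        then show ?thesis
          by (simp add: \<phi>_def)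
      qed
      then show ?thesis
        by (auto simp: eventually_sequentially)
    qed
    then have "\<forall>\<^sub>F k in sequentially. \<forall>m\<in>{..<m0}. \<phi> k m x = 0"
      by (intro eventually_ball_finite) auto
    then have "\<forall>\<^sub>F k in sequentially. (\<forall>m\<in>{..<m0}. \<phi> k m x = 0) \<and> m0 < k"
      by (intro eventually_conj eventually_gt_at_top)
    then show "\<forall>\<^sub>F k in sequentially. g k x = v (LEAST m. x \<in> C m)"
    proof eventually_elim
      case (elim k)
      have w: "w k m x = (if m = m0 then 1 else 0)" for m
      proof (cases m m0 rule: linorder_cases)
        case less
        then show ?thesis
          using elim by (simp add: w_def)
      next
        case equal
        have "(\<Prod>j<m0. 1 - \<phi> k j x) = 1"
          using elim by (intro prod.neutral) auto
        then show ?thesis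
          using equal one by (simp add: w_def)
      next
        case greater
        \<comment> \<open>The factor at \<open>m0\<close> vanishes for every \<open>k\<close>, so
          the sets after the first match never contribute.\<close>
        have "(\<Prod>j<m. 1 - \<phi> k j x) = 0"
          using greater one by (intro prod_zero) (auto intro!: bexI[of _ m0])
        then show ?thesis
          using greater by (simp add: w_def)
      qed
      have "g k x = (\<Sum>m<k. if m = m0 then v m else 0)"
        unfolding g_def w by (intro sum.cong) auto
      also have "\<dots> = v m0"
        using elim by simp
      finally show ?case
        by (simp add: m0_def)
    qed
  qed
  ultimately show thesis
    by (rule that)
qed

text \<open>Disjointifying the weights \<open>\<psi> i\<close> by subtracting \<open>i\<close> times the earlier ones makes the family locally
  finite without destroying the covering property.\<close>

lemma open_cover_selection:
  fixes A :: "nat \<Rightarrow> 'a::metric_space set" and y :: "nat \<Rightarrow> 'b"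
  assumes "\<And>i. open (A i)" "(\<Union>i. A i) = UNIV"
  obtains h where "continuous_on UNIV h" "\<And>x. h x \<in> convex hull {y i |i. x \<in> A i}"
proof -
  \<comment> \<open>\<open>A i = UNIV\<close> is separate because \<open>infdist\<close> to the
    empty complement is 0, not infinite.\<close>
  define \<psi> where "\<psi> = (\<lambda>i x. if A i = UNIV then 1 else min 1 (infdist x (- A i)))"
  define w where "w = (\<lambda>i x. max 0 (\<psi> i x - real i * (\<Sum>j<i. \<psi> j x)))"
  define W where "W = (\<lambda>N x. \<Sum>i<N. w i x)"
  have cont_\<psi>: "continuous_on UNIV (\<psi> i)" for i
    unfolding \<psi>_def by (cases "A i = UNIV") (auto intro!: continuous_intros)
  have cont_w: "continuous_on UNIV (w i)" for i
    unfolding w_def by (intro continuous_intros cont_\<psi>)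
  have \<psi>: "0 \<le> \<psi> i x" "\<psi> i x \<le> 1" for i x
    by (auto simp: \<psi>_def infdist_nonneg)
  have \<psi>_pos: "0 < \<psi> i x \<longleftrightarrow> x \<in> A i" for i x
  proof (cases "A i = UNIV")
    case False
    then have "x \<in> - A i \<longleftrightarrow> infdist x (- A i) = 0"
      using assms(1) by (intro in_closed_iff_infdist_zero) auto
    then show ?thesis
      using infdist_nonneg[of x "- A i"] False by (auto simp: \<psi>_def)
  qed (simp add: \<psi>_def)
  have w0: "0 \<le> w i x" for i x
    by (simp add: w_def)
  have w_pos: "x \<in> A i" if "0 < w i x" for i x
  proof -
    have "0 \<le> real i * (\<Sum>j<i. \<psi> j x)"
      by (intro mult_nonneg_nonneg sum_nonneg \<psi>) auto
    then have "0 < \<psi> i x"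
      using that by (simp add: w_def)
    then show ?thesis
      by (simp add: \<psi>_pos)
  qed
  \<comment> \<open>At the first set that contains \<open>x\<close> nothing is subtracted.\<close>
  have ex_pos: "\<exists>i. 0 < w i x" for x
  proof -
    define i where "i = (LEAST i. x \<in> A i)"
    have "\<exists>i. x \<in> A i"
      using assms(2) by blast
    then have i: "x \<in> A i" "\<And>j. j < i \<Longrightarrow> x \<notin> A j"
      unfolding i_def by (auto intro: LeastI dest: not_less_Least)
    then have "\<psi> j x = 0" if "j < i" for j
      using \<psi>(1)[of j x] \<psi>_pos[of j x] that by force
    then have "(\<Sum>j<i. \<psi> j x) = 0"
      by simp
    then have "w i x = \<psi> i x"
      using \<psi>(1)[of i x] by (simp add: w_def)
    then show ?thesis
      using i(1) \<psi>_pos by metis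
  qed
  \<comment> \<open>Near a point of \<open>A j\<close> the weight \<open>\<psi> j\<close> stays
    above half its value there. For \<open>i\<close> beyond \<open>j\<close> and beyond the inverse
    of that half, the subtracted term is at least 1, which bounds \<open>\<psi> i\<close>.\<close>
  have local: "\<exists>U N. open U \<and> x \<in> U \<and> (\<forall>z\<in>U. \<forall>i\<ge>N. w i z = 0)" for x
  proof -
    obtain j where "x \<in> A j"
      using assms(2) by blast
    then have pos: "0 < \<psi> j x"
      by (simp add: \<psi>_pos)
    define U where "U = {z. \<psi> j x / 2 < \<psi> j z}"
    have "open U"
      unfolding U_def using cont_\<psi> by (intro open_Collect_less continuous_intros)
    moreover have "x \<in> U"
      using pos by (simp add: U_def)
    moreover obtain N where N: "2 / \<psi> j x < real N"
      using reals_Archimedean2 by blast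
    have "w i z = 0" if "z \<in> U" "i \<ge> max N (Suc j)" for z i
    proof -
      have "1 \<le> real i * (\<psi> j x / 2)"
      proof -
        have "2 / \<psi> j x \<le> real i"
          using N that(2) by linarith
        then show ?thesis
          using pos by (simp add: divide_le_eq)
      qed
      also have "\<dots> \<le> real i * (\<Sum>j<i. \<psi> j z)"
      proof (intro mult_left_mono)
        have "\<psi> j x / 2 \<le> \<psi> j z"
          using that(1) by (simp add: U_def)
        also have "\<dots> \<le> (\<Sum>j<i. \<psi> j z)"
          using that(2) \<psi>(1) by (intro member_le_sum) auto
        finally show "\<psi> j x / 2 \<le> (\<Sum>j<i. \<psi> j z)" .
      qed simp
      finally show ?thesis
        using \<psi>(2)[of i z] by (simp add: w_def)
    qed
    ultimately show ?thesis
      by blast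
  qed
  define N where "N = (\<lambda>x. SOME n. \<forall>i\<ge>n. w i x = 0)"
  have N: "w i x = 0" if "i \<ge> N x" for i x
  proof -
    have "\<exists>n. \<forall>i\<ge>n. w i x = 0"
      using local[of x] by blast
    from someI_ex[OF this] show ?thesis
      using that by (simp add: N_def)
  qed
  \<comment> \<open>The cutoff \<open>N x\<close> jumps with \<open>x\<close>. Any cutoff beyond the
    nonzero weights gives the same value (\<open>h_eq\<close>), so near each point \<open>h\<close>
    is a sum of fixed length.\<close>
  define h where "h = (\<lambda>x. \<Sum>i<N x. (w i x / W (N x) x) *\<^sub>R y i)"
  have W_eq: "W n x = W (N x) x" if "\<forall>i\<ge>n. w i x = 0" for n x
    unfolding W_def using that N by (intro sum_lessThan_eq) auto
  have h_eq: "h x = (\<Sum>i<n. (w i x / W n x) *\<^sub>R y i)" if "\<forall>i\<ge>n. w i x = 0" for n x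
    unfolding h_def W_eq[OF that] using that N by (intro sum_lessThan_eq) auto
  have W_pos: "0 < W n x" if "\<forall>i\<ge>n. w i x = 0" for n x
  proof -
    obtain i where i: "0 < w i x"
      using ex_pos by blast
    then have "i < n"
      using that by (metis less_irrefl not_less)
    then have "w i x \<le> W n x"
      unfolding W_def using w0 by (intro member_le_sum) auto
    then show ?thesis
      using i by linarith
  qed
  have "continuous_on UNIV h"
    unfolding continuous_on_eq_continuous_at[OF open_UNIV]
  proof
    fix x
    obtain U n where U: "open U" "x \<in> U" "\<And>z. z \<in> U \<Longrightarrow> \<forall>i\<ge>n. w i z = 0"
      using local by metis
    have "continuous_on U (\<lambda>z. \<Sum>i<n. (w i z / W n z) *\<^sub>R y i)"
    proof (intro continuous_on_sum_scale continuous_on_divide)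
      show "continuous_on U (w i)" for i
        using cont_w continuous_on_subset by blast
      then show "continuous_on U (W n)"
        unfolding W_def by (intro continuous_on_sum)
      show "\<forall>z\<in>U. W n z \<noteq> 0"
        using W_pos U(3) by (metis less_irrefl)
    qed
    then have "continuous_on U h"
      by (rule continuous_on_eq) (simp add: h_eq[OF U(3)])
    then show "isCont h x"
      using U(1,2) by (simp add: continuous_on_eq_continuous_at)
  qed
  moreover have "h x \<in> convex hull {y i |i. x \<in> A i}" for x
  proof -
    define I where "I = {i. i < N x \<and> 0 < w i x}"
    have I: "finite I"
      by (simp add: I_def)
    have pos: "0 < W (N x) x"
      using W_pos N by blast
    have zero: "w i x = 0" if "i < N x" "i \<notin> I" for i
      using that w0[of i x] by (simp add: I_def)
    have "h x = (\<Sum>i\<in>I. (w i x / W (N x) x) *\<^sub>R y i)"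
      unfolding h_def using zero by (intro sum.mono_neutral_right) (auto simp: I_def)
    moreover have "(\<Sum>i\<in>I. (w i x / W (N x) x) *\<^sub>R y i) \<in> convex hull {y i |i. x \<in> A i}"
    proof (intro convex_sum I convex_convex_hull)
      have "(\<Sum>i\<in>I. w i x) = W (N x) x"
        unfolding W_def using zero by (intro sum.mono_neutral_left) (auto simp: I_def)
      then show "(\<Sum>i\<in>I. w i x / W (N x) x) = 1"
        using pos by (simp add: sum_divide_distrib[symmetric])
    next
      fix i assume "i \<in> I"
      then show "0 \<le> w i x / W (N x) x"
        using pos w0 by simp
      show "y i \<in> convex hull {y i |i. x \<in> A i}"
        using \<open>i \<in> I\<close> w_pos by (intro hull_inc) (auto simp: I_def)
    qed
    ultimately show ?thesis
      by simp
  qed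
  ultimately show thesis
    by (rule that)
qed

end

text \<open>First-match selection at class \<open>r\<close> is an assumption so that the lemma can
  be applied to the induction hypothesis of \<open>first_match_Baire_class\<close> and later to that
  result itself. All pieces of all \<open>S m\<close> are enumerated together; the first piece
  containing \<open>x\<close> remembers its \<open>m\<close>.\<close>

lemma pi_union_cover_selection:
  fixes S :: "nat \<Rightarrow> 'a::topological_space set" and v :: "nat \<Rightarrow> 'b::topological_space"
  assumes first_match: "\<And>C (u :: nat \<Rightarrow> 'b). (\<And>m::nat. Pi_class r (C m)) \<Longrightarrow> (\<Union>m. C m) = (UNIV :: 'a set) \<Longrightarrow>
      Baire_class r (\<lambda>x. u (LEAST m. x \<in> C m))"
    and S: "\<And>m. pi_union r (S m)" "(\<Union>m. S m) = UNIV"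
  obtains h where "Baire_class r h" "\<And>x. \<exists>m. x \<in> S m \<and> h x = v m"
proof -
  obtain B where B: "\<And>m i. Pi_class r (B m i)" "\<And>m. S m = (\<Union>i::nat. B m i)"
    using S(1) unfolding pi_union_def by metis
  define C where "C = (\<lambda>k. B (fst (prod_decode k)) (snd (prod_decode k)))"
  define h where "h = (\<lambda>x. v (fst (prod_decode (LEAST k. x \<in> C k))))"
  have C: "(\<Union>k. C k) = UNIV"
    unfolding C_def UN_prod_decode using B(2) S(2) by simp
  have "Pi_class r (C k)" for k
    by (simp add: C_def B(1))
  then have "Baire_class r h"
    unfolding h_def using C by (rule first_match[where u = "\<lambda>k. v (fst (prod_decode k))"])
  moreover have "\<exists>m. x \<in> S m \<and> h x = v m" for x
  proof -
    have "\<exists>k. x \<in> C k"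
      using C by blast
    then have "x \<in> C (LEAST k. x \<in> C k)"
      by (rule LeastI_ex)
    then have "x \<in> S (fst (prod_decode (LEAST k. x \<in> C k)))"
      unfolding B(2) by (auto simp: C_def)
    then show ?thesis
      by (auto simp: h_def)
  qed
  ultimately show thesis
    by (rule that)
qed

lemma Pi_class_one_closed:
  assumes "r =o one_ord" "Pi_class r C"
  shows "closed C"
proof -
  have r: "\<not> one_ord <o r"
    using assms(1) not_ordLess_ordIso ordIso_symmetric by blast
  have "open (- C)"
    using assms(2)[unfolded Pi_class_def] by (cases rule: Sigma_class_cases) (simp_all add: r)
  then show ?thesis
    by (simp add: closed_def)
qed

context Frechet
begin

text \<open>For \<open>r\<close> above 1, each \<open>C m\<close> is the intersection of sets \<open>D m i\<close> of lower additive
  class. At stage \<open>k\<close> replace \<open>C m\<close> by the intersection of the first \<open>k\<close> of them; the first match is then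
  eventually the right one.\<close>

lemma first_match_Baire_class:
  fixes C :: "nat \<Rightarrow> 'a::metric_space set" and v :: "nat \<Rightarrow> 'b"
  assumes "one_ord \<le>o r" "\<And>m. Pi_class r (C m)" "(\<Union>m. C m) = UNIV"
  shows "Baire_class r (\<lambda>x. v (LEAST m. x \<in> C m))"
  using assms
proof (induction r arbitrary: C v rule: wf_induct_rule[OF wf_ordLess])
  case (1 r)
  note one = 1(2) and Pi = 1(3) and cover = 1(4)
  have Least: "x \<in> C (LEAST m. x \<in> C m)" for x
    by (rule LeastI_ex) (use cover in blast)
  show "Baire_class r (\<lambda>x. v (LEAST m. x \<in> C m))"
  proof (cases "one_ord <o r")
    case False
    then have "r =o one_ord"
      using one ordLeq_iff_ordLess_or_ordIso[of one_ord r] ordIso_symmetric[of one_ord r] by simp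
    then have "closed (C m)" for m
      using Pi by (rule Pi_class_one_closed)
    then obtain g :: "nat \<Rightarrow> 'a \<Rightarrow> 'b" where g: "\<And>k. continuous_on UNIV (g k)"
      "\<And>x. (\<lambda>k. g k x) \<longlonglongrightarrow> v (LEAST m. x \<in> C m)"
      using closed_first_match[OF _ cover] by metis
    have empty: "Well_order {}" "Field {} = {}"
      by simp_all
    have "Baire_class {} (g k)" for k
      using empty g(1) by (rule Baire_zero)
    moreover have "({} :: nat rel) <o r"
      using zero_ordLess_iff[OF empty, of r] one by simp
    ultimately show ?thesis
      using one g(2) by (intro Baire_class_limI[where g = g]) auto
  next
    case True
    have "\<exists>D. C m = (\<Inter>i. D i) \<and> (\<forall>i::nat. \<exists>s. s <o r \<and> Sigma_class s (D i))" for m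
      using Pi[of m, unfolded Pi_class_def]
    proof (cases rule: Sigma_class_cases)
      case one
      then show ?thesis
        using True not_ordLess_ordIso ordIso_symmetric by blast
    next
      case (union B)
      have "C m = (\<Inter>i. - B i)"
        using union(2) by blast
      moreover have "\<exists>s. s <o r \<and> Sigma_class s (- B i)" for i
        using union(3)[of i] by (elim exE) auto
      ultimately show ?thesis
        by (intro exI[of _ "\<lambda>i. - B i"]) simp
    qed
    then obtain D where D: "\<And>m. C m = (\<Inter>i. D m i)"
      "\<And>m i::nat. \<exists>s. s <o r \<and> Sigma_class s (D m i)"
      by metis
    then obtain s where s: "\<And>m i. s m i <o r" "\<And>m i. Sigma_class (s m i) (D m i)"
      by metis
    \<comment> \<open>\<open>min i k\<close> cuts the intersection down to indices up to
      \<open>k\<close>. The default \<open>UNIV\<close> from \<open>m = k\<close> on guarantees a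
      match and leaves finitely many classes \<open>s m i\<close>, so one class \<open>t\<close>
      below \<open>r\<close> serves the whole stage.\<close>
    define E where "E = (\<lambda>k m. if m < k then (\<Inter>i. D m (min i k)) else UNIV)"
    have E: "\<exists>h t. t <o r \<and> Baire_class t h \<and> (\<forall>x. h x = v (LEAST m. x \<in> E k m))" for k
    proof -
      obtain t :: "nat rel" where t: "t <o r" "one_ord \<le>o t"
        "\<And>m i. m \<le> k \<Longrightarrow> i \<le> k \<Longrightarrow> s m i \<le>o t"
      proof -
        have "\<exists>t :: nat rel. t <o r \<and> one_ord \<le>o t \<and> (\<forall>u\<in>(\<lambda>(m, i). s m i) ` ({..k} \<times> {..k}). u \<le>o t)"
          using s(1) True by (intro finite_ordLess_bound) auto
        then show thesis
          using that by auto
      qed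
      have "Sigma_class t (D m i)" if "m < k" "i \<le> k" for m i
        using Sigma_class_mono[OF s(2) t(3)] that by simp
      then have D_pi: "pi_union t (D m i)" "pi_union t (- D m i)" if "m < k" "i \<le> k" for m i
        using that by (simp_all add: Sigma_class_imp_pi_union pi_union_Pi Pi_class_def)
      have E_pi: "pi_union t (E k m)" "pi_union t (- E k m)" for m
      proof -
        have "range (\<lambda>i. min i k) = {..k}"
          by (force simp: min_def)
        then have "(\<Inter>i. D m (min i k)) = (\<Inter>i\<in>{..k}. D m i)"
          by (metis image_image)
        moreover have "pi_union t (\<Inter>i\<in>{..k}. D m i)" if "m < k"
          using D_pi(1)[OF that] t(2) by (intro pi_union_INT) auto
        ultimately have "pi_union t (\<Inter>i. D m (min i k))" if "m < k"
          using that by simp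
        moreover have "pi_union t (UNIV :: 'a set)" "pi_union t ({} :: 'a set)"
          using t(2) by (simp_all add: Sigma_class_imp_pi_union open_Sigma_class)
        moreover have "pi_union t (\<Union>i. - D m (min i k))" if "m < k"
          using D_pi(2)[OF that min.cobounded2] by (intro pi_union_UN_nat)
        ultimately show "pi_union t (E k m)" "pi_union t (- E k m)"
          unfolding E_def by simp_all
      qed
      \<comment> \<open>The sets \<open>S m\<close> are disjoint, so a selection subordinate to them
        must return the first match. They are of type \<open>pi_union t\<close> because both
        \<open>E k m\<close> and its complement are.\<close>
      define S where "S = (\<lambda>m. E k m \<inter> (\<Inter>j\<in>{..<m}. - E k j))"
      have ex: "\<exists>m. x \<in> E k m" for x
        by (auto simp: E_def)
      have S: "x \<in> S m \<longleftrightarrow> m = (LEAST m. x \<in> E k m)" for x m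
      proof
        assume "x \<in> S m"
        then have "x \<in> E k m" "\<And>j. x \<in> E k j \<Longrightarrow> m \<le> j"
          by (force simp: S_def not_less[symmetric])+
        then show "m = (LEAST m. x \<in> E k m)"
          by (intro Least_equality[symmetric])
      next
        assume m: "m = (LEAST m. x \<in> E k m)"
        then show "x \<in> S m"
          using LeastI_ex[OF ex[of x]] by (auto simp: S_def dest: not_less_Least)
      qed
      have S_pi: "pi_union t (S m)" for m
        unfolding S_def using E_pi t(2) by (intro pi_union_Int pi_union_INT) auto
      have S_cover: "(\<Union>m. S m) = UNIV"
        using S by blast
      obtain h where h: "Baire_class t h" "\<And>x. \<exists>m. x \<in> S m \<and> h x = v m"
        using pi_union_cover_selection[OF 1(1)[OF t(1,2)] S_pi S_cover, of v] by metis
      have "h x = v (LEAST m. x \<in> E k m)" for x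
        using h(2)[of x] S by auto
      then show ?thesis
        using t(1) h(1) by auto
    qed
    then obtain h where h: "\<And>k. \<exists>t. t <o r \<and> Baire_class t (h k)"
      "\<And>k x. h k x = v (LEAST m. x \<in> E k m)"
      by metis
    show ?thesis
    proof (rule Baire_class_limI[OF one h(1)])
      fix x
      define m0 where "m0 = (LEAST m. x \<in> C m)"
      have m0: "x \<in> C m0" "\<And>m. m < m0 \<Longrightarrow> x \<notin> C m"
        using Least[of x] unfolding m0_def by (auto dest: not_less_Least)
      have "\<forall>\<^sub>F k in sequentially. x \<notin> E k m" if m: "m < m0" for m
      proof -
        obtain i where i: "x \<notin> D m i"
          using m0(2)[OF m] D(1) by blast
        have "x \<notin> E k m" if k: "k \<ge> max i (Suc m)" for k
        proof -
          have "m < k" "min i k = i"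
            using k by auto
          then show ?thesis
            using i unfolding E_def by (auto intro!: exI[of _ i])
        qed
        then show ?thesis
          unfolding eventually_sequentially by blast
      qed
      then have "\<forall>\<^sub>F k in sequentially. \<forall>m\<in>{..<m0}. x \<notin> E k m"
        by (intro eventually_ball_finite) auto
      then have "\<forall>\<^sub>F k in sequentially. h k x = v m0"
      proof eventually_elim
        case (elim k)
        have "x \<in> E k m0"
          using m0(1) D(1) by (auto simp: E_def)
        moreover have "m0 \<le> m" if "x \<in> E k m" for m
          using elim that by (meson lessThan_iff not_less)
        ultimately have "(LEAST m. x \<in> E k m) = m0"
          by (intro Least_equality)
        then show ?case
          by (simp add: h(2))
      qed
      then show "(\<lambda>k. h k x) \<longlonglongrightarrow> v (LEAST m. x \<in> C m)"
        unfolding m0_def by (rule tendsto_eventually)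
    qed
  qed
qed

text \<open>The convex hull unites two cases: above class 1 some \<open>y i\<close> is itself
  chosen, whereas a continuous function can in general only average.\<close>

lemma Sigma_cover_selection:
  fixes A :: "nat \<Rightarrow> 'a::metric_space set" and y :: "nat \<Rightarrow> 'b"
  assumes p: "p <o r" "\<And>s :: nat rel. s <o r \<Longrightarrow> s \<le>o p"
    and A: "\<And>i. Sigma_class r (A i)" "(\<Union>i. A i) = UNIV"
  obtains h where "Baire_class p h" "\<And>x. h x \<in> convex hull {y i |i. x \<in> A i}"
proof (cases "one_ord <o r")
  case True
  have "pi_union p (A i)" for i
    using pi_union_Sigma_succ[OF A(1) True p(2)] .
  then obtain h where h: "Baire_class p h" "\<And>x. \<exists>i. x \<in> A i \<and> h x = y i"
    using pi_union_cover_selection[OF first_match_Baire_class[OF p(2)[OF True]] _ A(2), where v = y] by metis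
  then have "h x \<in> convex hull {y i |i. x \<in> A i}" for x
    using h(2)[of x] by (intro hull_inc) auto
  with h(1) show thesis
    by (rule that)
next
  case False
  have "open (A i)" for i
    using A(1)[of i] by (cases rule: Sigma_class_cases) (simp_all add: False)
  note open_A = this
  obtain h where h: "continuous_on UNIV h" "\<And>x. h x \<in> convex hull {y i |i. x \<in> A i}"
    by (rule open_cover_selection[OF open_A A(2), of y]) (rule that)
  have "r =o one_ord"
    using A(1)[of 0] by (cases rule: Sigma_class_cases) (simp_all add: False)
  then obtain k where "Field r = {k}"
    by (auto simp: ordIso_one_iff)
  then have "Field p = {}"
    using ordLess_singleton_Field[OF p(1)] by simp
  then have "Baire_class p h"
    using ordLess_Well_order(1)[OF p(1)] h(1) by (simp add: Baire_zero)
  then show thesis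
    using h(2) by (rule that)
qed

end

section \<open>Rational convex combinations\<close>

text \<open>Rounds of binary combinations replace coefficient vectors: convexity is a two-point
  condition, and the class of a combination follows from \<open>Baire_class_binary\<close>.\<close>

primrec rational_combs :: "('a \<Rightarrow> 'b::real_vector) set \<Rightarrow> nat \<Rightarrow> ('a \<Rightarrow> 'b) set" where
  "rational_combs S 0 = S"
| "rational_combs S (Suc n) =
     (\<lambda>(q, h, k) x. of_rat q *\<^sub>R h x + (1 - of_rat q) *\<^sub>R k x) `
       ({0..1} \<times> rational_combs S n \<times> rational_combs S n)"

definition rational_hull :: "('a \<Rightarrow> 'b::real_vector) set \<Rightarrow> ('a \<Rightarrow> 'b) set" where
  "rational_hull S = (\<Union>n. rational_combs S n)"

lemma rational_hull_base: "S \<subseteq> rational_hull S"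
  unfolding rational_hull_def using rational_combs.simps(1)[of S] by blast

lemma countable_rational_hull: "countable S \<Longrightarrow> countable (rational_hull S)"
proof -
  assume "countable S"
  then have "countable (rational_combs S n)" for n
    by (induction n) auto
  then show ?thesis
    by (simp add: rational_hull_def)
qed

lemma rational_hull_step:
  assumes "h \<in> rational_hull S" "k \<in> rational_hull S" "0 \<le> q" "q \<le> 1"
  shows "(\<lambda>x. of_rat q *\<^sub>R h x + (1 - of_rat q) *\<^sub>R k x) \<in> rational_hull S"
proof -
  have "rational_combs S n \<subseteq> rational_combs S (Suc n)" for n
  proof
    fix h assume h: "h \<in> rational_combs S n"
    \<comment> \<open>Coefficient 1 reproduces \<open>h\<close>, so the levels increase and two
      functions can be brought to a common one.\<close>
    have "(1 :: rat, h, h) \<in> {0..1} \<times> rational_combs S n \<times> rational_combs S n"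
      using h by simp
    then have "(\<lambda>(q, h, k) x. of_rat q *\<^sub>R h x + (1 - of_rat q) *\<^sub>R k x) (1, h, h) \<in> rational_combs S (Suc n)"
      unfolding rational_combs.simps(2) by (rule imageI)
    then show "h \<in> rational_combs S (Suc n)"
      by simp
  qed
  then have mono: "m \<le> n \<Longrightarrow> rational_combs S m \<subseteq> rational_combs S n" for m n
    by (rule lift_Suc_mono_le)
  obtain m n where "h \<in> rational_combs S m" "k \<in> rational_combs S n"
    using assms(1,2) by (auto simp: rational_hull_def)
  then have "h \<in> rational_combs S (max m n)" "k \<in> rational_combs S (max m n)"
    using mono by (meson max.cobounded1 max.cobounded2 subsetD)+
  then have "(q, h, k) \<in> {0..1} \<times> rational_combs S (max m n) \<times> rational_combs S (max m n)"
    using assms(3,4) by simp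
  then have "(\<lambda>(q, h, k) x. of_rat q *\<^sub>R h x + (1 - of_rat q) *\<^sub>R k x) (q, h, k)
      \<in> rational_combs S (Suc (max m n))"
    unfolding rational_combs.simps(2) by (rule imageI)
  then show ?thesis
    unfolding rational_hull_def by (intro UN_I[of "Suc (max m n)"]) simp_all
qed

lemma rational_hull_induct [consumes 1, case_names base step]:
  assumes "h \<in> rational_hull S"
    and base: "\<And>h. h \<in> S \<Longrightarrow> P h"
    and step: "\<And>q h k. 0 \<le> q \<Longrightarrow> q \<le> 1 \<Longrightarrow> P h \<Longrightarrow> P k \<Longrightarrow>
      P (\<lambda>x. of_rat q *\<^sub>R h x + (1 - of_rat q) *\<^sub>R k x)"
  shows "P h"
proof -
  obtain n where "h \<in> rational_combs S n"
    using assms(1) by (auto simp: rational_hull_def)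
  then show ?thesis
  proof (induction n arbitrary: h)
    case 0
    then show ?case
      using base by simp
  next
    case (Suc n)
    then show ?case
      using step by auto
  qed
qed

lemma rational_hull_mono: "S \<subseteq> T \<Longrightarrow> rational_hull S \<subseteq> rational_hull T"
proof
  fix h assume "S \<subseteq> T" "h \<in> rational_hull S"
  from this(2) show "h \<in> rational_hull T"
  proof (induction rule: rational_hull_induct)
    case (base h)
    then show ?case
      using \<open>S \<subseteq> T\<close> rational_hull_base by blast
  qed (rule rational_hull_step)
qed

lemma rational_neighbour:
  assumes "open S" "u \<in> S" "0 \<le> u" "u \<le> (1::real)"
  obtains q where "0 \<le> q" "q \<le> 1" "of_rat q \<in> S"
proof (cases "u = 0 \<or> u = 1")
  case True
  then show ?thesis
    using assms(2) that[of 0] that[of 1] by auto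
next
  case False
  then have u: "u \<in> S \<inter> {0<..<1}"
    using assms by auto
  have "open (S \<inter> {0<..<1})"
    using assms(1) by (intro open_Int) auto
  then obtain e where e: "0 < e" "ball u e \<subseteq> S \<inter> {0<..<1}"
    using u open_contains_ball by metis
  obtain q where "u < of_rat q" "of_rat q < u + e"
    using of_rat_dense[of u "u + e"] e(1) by auto
  then have "of_rat q \<in> ball u e"
    by (simp add: dist_real_def)
  then have q: "of_rat q \<in> S \<inter> {0<..<1::real}"
    using e(2) by blast
  then show ?thesis
    by (intro that[of q]) (auto simp: zero_less_of_rat_iff of_rat_less_1_iff less_imp_le)
qed

lemma diameter_leI:
  fixes S :: "'a::metric_space set"
  assumes "S \<noteq> {}" "\<And>x y. x \<in> S \<Longrightarrow> y \<in> S \<Longrightarrow> dist x y \<le> d"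
  shows "diameter S \<le> d"
  using assms unfolding diameter_def by (auto intro!: cSUP_least)

context Frechet
begin

lemma open_diff_vimage:
  assumes "open (V :: 'b set)"
  shows "open {z. z - c \<in> V}" "open {z. c - z \<in> V}"
  using open_vimage[OF assms continuous_on_minus[OF continuous_on_id continuous_on_const]]
    open_vimage[OF assms continuous_on_minus[OF continuous_on_const continuous_on_id]]
  by (simp_all add: vimage_def)

section \<open>From Baire functions to strips\<close>

text \<open>The classes of the members of \<open>S\<close> may be cofinal in \<open>r\<close>, but a
  combination involves finitely many members, whose largest class is still below
  \<open>r\<close>.\<close>

lemma Baire_class_rational_hull:
  fixes S :: "('a::metric_space \<Rightarrow> 'b) set"
  assumes "\<And>h. h \<in> S \<Longrightarrow> \<exists>s. s <o r \<and> Baire_class s h" "h \<in> rational_hull S"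
  shows "\<exists>s. s <o r \<and> Baire_class s h"
  using assms(2)
proof (induction rule: rational_hull_induct)
  case (base h)
  then show ?case
    by (rule assms(1))
next
  case (step q h k)
  obtain t where t: "t <o r" "Baire_class t h" "Baire_class t k"
    by (rule Baire_class_common[OF step(3,4)]) (rule that)
  have "continuous_on UNIV (\<lambda>p::'b \<times> 'b. of_rat q *\<^sub>R fst p + (1 - of_rat q) *\<^sub>R snd p)"
    by (intro continuous_on_plus continuous_on_scale continuous_intros)
  from Baire_class_binary[OF this t(2,3)] show ?case
    using t(1) by auto
qed

lemma Baire_class_imp_strips:
  fixes f :: "'a::metric_space \<Rightarrow> 'b"
  assumes r: "one_ord \<le>o r" and f: "Baire_class r f"
  shows "\<exists>G :: nat \<Rightarrow> ('a \<times> 'b) set.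
       (\<forall>n. Sigma_strip r (G n)) \<and>
       (\<forall>n. G (Suc n) \<subseteq> G n) \<and>
       (\<Inter>n. G n) = graph f \<and>
       (\<forall>x. (\<forall>\<^sub>F n in sequentially. bounded (slice (G n) x)) \<and>
            (\<lambda>n. diameter (slice (G n) x)) \<longlonglongrightarrow> 0) \<and>
       (\<forall>n U. open U \<longrightarrow> Sigma_class r (fst ` ((UNIV \<times> U) \<inter> G n)))"
proof -
  obtain g where g: "\<And>n::nat. \<exists>s. s <o r \<and> Baire_class s (g n)" "\<And>x. (\<lambda>n. g n x) \<longlonglongrightarrow> f x"
    using f
  proof (cases rule: Baire_class_cases)
    case zero
    then show ?thesis
      using r by (simp add: one_ordLeq_iff)
  next
    case (limit g)
    then show ?thesis
      by (intro that[of g])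
  qed
  have "\<exists>V :: 'b set. open V \<and> convex V \<and> 0 \<in> V \<and> V \<subseteq> ball 0 (inverse (Suc n))" for n
    by (rule convex_neighbourhood[of "inverse (Suc n)"]) auto
  then obtain V0 :: "nat \<Rightarrow> 'b set" where V0: "\<And>n. open (V0 n)" "\<And>n. convex (V0 n)" "\<And>n. 0 \<in> V0 n"
      "\<And>n. V0 n \<subseteq> ball 0 (inverse (Suc n))"
    by metis
  \<comment> \<open>Intersecting makes the neighbourhoods decrease, as the strips must.\<close>
  define V where "V = (\<lambda>n. \<Inter>i\<in>{..n}. V0 i)"
  have V: "open (V n)" "convex (V n)" "0 \<in> V n" "V n \<subseteq> ball 0 (inverse (Suc n))" "V (Suc n) \<subseteq> V n" for n
  proof -
    show "open (V n)" "convex (V n)" "0 \<in> V n"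
      unfolding V_def using V0 by (auto intro!: open_INT convex_INT)
    have "V n \<subseteq> V0 n"
      by (auto simp: V_def)
    then show "V n \<subseteq> ball 0 (inverse (Suc n))"
      using V0(4) by blast
    show "V (Suc n) \<subseteq> V n"
      by (auto simp: V_def)
  qed
  define H where "H = (\<lambda>n. rational_hull (g ` {n..}))"
  have H_mono: "H (Suc n) \<subseteq> H n" for n
    unfolding H_def by (intro rational_hull_mono image_mono) auto
  have g_H: "g m \<in> H n" if "n \<le> m" for m n
    using rational_hull_base[of "g ` {n..}"] that by (auto simp: H_def)
  have H_countable: "countable (H n)" for n
    by (simp add: H_def countable_rational_hull)
  have H_Baire: "\<exists>s. s <o r \<and> Baire_class s h" if "h \<in> H n" for h n
    by (rule Baire_class_rational_hull[OF _ that[unfolded H_def]]) (use g(1) in auto)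
  define G where "G = (\<lambda>n. {(x, y). \<exists>h\<in>H n. y - h x \<in> V n})"
  have slice_G: "slice (G n) x = {y. \<exists>h\<in>H n. y - h x \<in> V n}" for n x
    by (simp add: slice_def G_def)
  have "Sigma_class r (G n)" for n
  proof -
    have "Sigma_class r ((\<lambda>z. snd z - h (fst z)) -` V n)" if h: "h \<in> H n" for h
    proof -
      obtain s where s: "s <o r" "Baire_class s h"
        using H_Baire[OF h] by auto
      have "continuous_on UNIV (\<lambda>p::('a \<times> 'b) \<times> 'b. snd (fst p) - snd p)"
        by (intro continuous_on_minus continuous_intros)
      from Baire_class_compose[OF s(2) continuous_on_fst[OF continuous_on_id] this]
      have "Baire_class s (\<lambda>z::'a \<times> 'b. snd z - h (fst z))"
        by simp
      then show ?thesis
        using s(1) V(1) by (rule Baire_class_vimage_open)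
    qed
    then have "Sigma_class r (\<Union>h\<in>H n. (\<lambda>z. snd z - h (fst z)) -` V n)"
      using H_countable r by (intro Sigma_class_UNION)
    moreover have "G n = (\<Union>h\<in>H n. (\<lambda>z. snd z - h (fst z)) -` V n)"
      by (auto simp: G_def)
    ultimately show ?thesis
      by simp
  qed
  moreover have "convex (slice (G n) x)" for n x
  proof (rule convexI)
    fix y y' and u v :: real
    assume "y \<in> slice (G n) x" "y' \<in> slice (G n) x" and uv: "0 \<le> u" "0 \<le> v" "u + v = 1"
    then obtain h h' where h: "h \<in> H n" "h' \<in> H n" "y - h x \<in> V n" "y' - h' x \<in> V n"
      by (auto simp: slice_G)
    \<comment> \<open>\<open>\<phi> t\<close> compares the combined point with the combination of
      \<open>h x\<close> and \<open>h' x\<close> with coefficient \<open>t\<close>. By convexity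
      \<open>\<phi> u\<close> is in \<open>V n\<close>; openness then permits a rational
      coefficient, which may depend on \<open>x\<close>.\<close>
    define \<phi> where "\<phi> = (\<lambda>t. (u *\<^sub>R y + v *\<^sub>R y') - (t *\<^sub>R h x + (1 - t) *\<^sub>R h' x))"
    have "continuous_on UNIV \<phi>"
      unfolding \<phi>_def
      by (intro continuous_on_minus continuous_on_plus continuous_on_scale continuous_intros)
    then have "open (\<phi> -` V n)"
      using V(1) by (simp add: open_vimage)
    moreover have "\<phi> u = u *\<^sub>R (y - h x) + v *\<^sub>R (y' - h' x)"
      using uv(3) by (simp add: \<phi>_def algebra_simps flip: scaleR_add_left)
    then have "u \<in> \<phi> -` V n"
      using convexD[OF V(2) h(3,4) uv] by simp
    ultimately obtain q where q: "0 \<le> q" "q \<le> 1" "of_rat q \<in> \<phi> -` V n"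
      using uv by (elim rational_neighbour) auto
    have "(\<lambda>x. of_rat q *\<^sub>R h x + (1 - of_rat q) *\<^sub>R h' x) \<in> H n"
      using h(1,2) q(1,2) unfolding H_def by (rule rational_hull_step)
    then show "u *\<^sub>R y + v *\<^sub>R y' \<in> slice (G n) x"
      using q(3) by (auto simp: slice_G \<phi>_def)
  qed
  ultimately have strip: "Sigma_strip r (G n)" for n
    by (simp add: Sigma_strip_def)
  have G_mono: "G (Suc n) \<subseteq> G n" for n
    unfolding G_def using H_mono V(5) by blast
  \<comment> \<open>One half of \<open>e\<close> is for a convex \<open>W\<close> that contains all
    late \<open>g m x - f x\<close>, hence also \<open>h x - f x\<close> for their combinations
    \<open>h\<close>; the other half is for \<open>V n\<close>.\<close>
  have near: "\<exists>N. \<forall>n\<ge>N. \<forall>y\<in>slice (G n) x. dist y (f x) < e" if "0 < e" for x and e :: real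
  proof -
    have e2: "0 < e / 2"
      using that by simp
    obtain W :: "'b set" where W: "open W" "convex W" "0 \<in> W" "W \<subseteq> ball 0 (e / 2)"
      by (rule convex_neighbourhood[OF e2]) (rule that)
    have "\<forall>\<^sub>F m in sequentially. g m x \<in> {z. z - f x \<in> W}"
      using g(2) W by (intro topological_tendstoD open_diff_vimage) auto
    then obtain N1 where N1: "\<And>m. m \<ge> N1 \<Longrightarrow> g m x - f x \<in> W"
      by (auto simp: eventually_sequentially)
    have hW: "h x - f x \<in> W" if "h \<in> H n" "n \<ge> N1" for h n
      using that(1) unfolding H_def
    proof (induction rule: rational_hull_induct)
      case (base h)
      then show ?case
        using N1 that(2) by auto
    next
      case (step q h k)
      have "of_rat q *\<^sub>R (h x - f x) + (1 - of_rat q) *\<^sub>R (k x - f x) \<in> W"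
        using step W(2) by (intro convexD) auto
      then show ?case
        by (simp add: algebra_simps)
    qed
    obtain N2 where N2: "inverse (real (Suc N2)) < e / 2"
      using reals_Archimedean[OF e2] by auto
    have "dist y (f x) < e" if n: "n \<ge> max N1 N2" and y: "y \<in> slice (G n) x" for n y
    proof -
      obtain h where h: "h \<in> H n" "y - h x \<in> V n"
        using y by (auto simp: slice_G)
      have "dist y (h x) < inverse (real (Suc n))"
        using subsetD[OF V(4) h(2)] dist_diff[of "h x" y] dist_commute[of y "h x"] by simp
      also have "\<dots> \<le> inverse (real (Suc N2))"
        using n by (intro le_imp_inverse_le) auto
      finally have "dist y (h x) < e / 2"
        using N2 by simp
      moreover have "dist (h x) (f x) < e / 2"
        using subsetD[OF W(4) hW[OF h(1)]] n dist_diff[of "f x" "h x"] dist_commute[of "h x" "f x"] by simp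
      ultimately show ?thesis
        using dist_triangle[of y "f x" "h x"] by linarith
    qed
    then show ?thesis
      by blast
  qed
  have f_slice: "f x \<in> slice (G n) x" for n x
  proof -
    have "\<forall>\<^sub>F m in sequentially. g m x \<in> {z. f x - z \<in> V n}"
      using g(2) V by (intro topological_tendstoD open_diff_vimage) auto
    then obtain N where "\<And>m. m \<ge> N \<Longrightarrow> f x - g m x \<in> V n"
      by (auto simp: eventually_sequentially)
    then have "f x - g (max n N) x \<in> V n"
      by simp
    then show ?thesis
      using g_H[of n "max n N"] by (auto simp: slice_G)
  qed
  have "(\<Inter>n. G n) = graph f"
  proof (intro subset_antisym subsetI)
    fix z assume z: "z \<in> (\<Inter>n. G n)"
    obtain x y where xy: "z = (x, y)"
      by fastforce
    have "y = f x"
    proof (rule ccontr)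
      assume "y \<noteq> f x"
      then obtain N where "\<forall>n\<ge>N. \<forall>w\<in>slice (G n) x. dist w (f x) < dist y (f x)"
        using near[of "dist y (f x)" x] by auto
      moreover have "y \<in> slice (G N) x"
        using z xy by (simp add: slice_def)
      ultimately show False
        by blast
    qed
    then show "z \<in> graph f"
      by (simp add: graph_def xy)
  next
    fix z assume "z \<in> graph f"
    then show "z \<in> (\<Inter>n. G n)"
      using f_slice by (auto simp: graph_def slice_def)
  qed
  \<comment> \<open>The real-valued \<open>diameter\<close> controls distances only in bounded
    sets.\<close>
  moreover have bdd: "\<forall>\<^sub>F n in sequentially. bounded (slice (G n) x)" for x
  proof -
    obtain N where "\<forall>n\<ge>N. \<forall>y\<in>slice (G n) x. dist y (f x) < 1"
      using near[of 1 x] by auto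
    then have "\<forall>n\<ge>N. bounded (slice (G n) x)"
      unfolding bounded_def by (metis dist_commute less_imp_le)
    then show ?thesis
      by (auto simp: eventually_sequentially)
  qed
  moreover have "(\<lambda>n. diameter (slice (G n) x)) \<longlonglongrightarrow> 0" for x
  proof (rule tendstoI)
    fix e :: real assume e: "0 < e"
    \<comment> \<open>A third and not a half: the supremum in \<open>diameter\<close> loses
      strictness.\<close>
    then obtain N where "\<forall>n\<ge>N. \<forall>y\<in>slice (G n) x. dist y (f x) < e / 3"
      using near[of "e / 3" x] by auto
    then have "\<forall>\<^sub>F n in sequentially. \<forall>y\<in>slice (G n) x. dist y (f x) < e / 3"
      by (auto simp: eventually_sequentially)
    with bdd[of x] show "\<forall>\<^sub>F n in sequentially. dist (diameter (slice (G n) x)) 0 < e"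
    proof eventually_elim
      case (elim n)
      have "diameter (slice (G n) x) \<le> 2 * (e / 3)"
      proof (rule diameter_leI)
        show "slice (G n) x \<noteq> {}"
          using f_slice by blast
        show "dist y z \<le> 2 * (e / 3)" if "y \<in> slice (G n) x" "z \<in> slice (G n) x" for y z
          using bspec[OF elim(2) that(1)] bspec[OF elim(2) that(2)] dist_triangle2[of y z "f x"] by simp
      qed
      then show ?case
        using diameter_ge_0[OF elim(1)] e by simp
    qed
  qed
  moreover have "Sigma_class r (fst ` ((UNIV \<times> U) \<inter> G n))" if U: "open U" for U n
  proof -
    \<comment> \<open>A projection need not preserve Borel classes. Here \<open>x\<close> is in the
      projection iff some \<open>h x\<close> lies in the open set \<open>T\<close>, the algebraic
      difference of \<open>U\<close> and \<open>V n\<close>; this gives countably many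
      preimages.\<close>
    define T where "T = (\<Union>y\<in>U. {z. y - z \<in> V n})"
    have "open T"
      unfolding T_def using V(1) open_diff_vimage by blast
    have "Sigma_class r (h -` T)" if h: "h \<in> H n" for h
    proof -
      obtain s where s: "s <o r" "Baire_class s h"
        using H_Baire[OF h] by auto
      show ?thesis
        using s(2,1) \<open>open T\<close> by (rule Baire_class_vimage_open)
    qed
    then have "Sigma_class r (\<Union>h\<in>H n. h -` T)"
      using H_countable r by (intro Sigma_class_UNION)
    moreover have "fst ` ((UNIV \<times> U) \<inter> G n) = (\<Union>h\<in>H n. h -` T)"
      by (force simp: T_def G_def)
    ultimately show ?thesis
      by simp
  qed
  ultimately show ?thesis
    using strip G_mono by (intro exI[of _ G]) simp
qed

section \<open>From strips to Baire functions\<close>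

lemma strips_imp_Baire_class:
  fixes f :: "'a::metric_space \<Rightarrow> 'b" and G :: "nat \<Rightarrow> ('a \<times> 'b) set" and p :: "nat rel"
  assumes p: "p <o r" "\<And>s :: nat rel. s <o r \<Longrightarrow> s \<le>o p"
    and convex: "\<And>n x. convex (slice (G n) x)"
    and f: "\<And>n x. f x \<in> slice (G n) x"
    and bounded: "\<And>x. \<forall>\<^sub>F n in sequentially. bounded (slice (G n) x)"
    and diam: "\<And>x. (\<lambda>n. diameter (slice (G n) x)) \<longlonglongrightarrow> 0"
    and proj: "\<And>n U. open U \<Longrightarrow> Sigma_class r (fst ` ((UNIV \<times> U) \<inter> G n))"
  shows "Baire_class r f"
proof -
  obtain d :: "nat \<Rightarrow> 'b" where d: "closure (range d) = UNIV"
    by (rule dense_sequence)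
  have "\<exists>h. Baire_class p h \<and> (\<forall>x. \<exists>y\<in>slice (G n) x. dist (h x) y < inverse (Suc n))" for n
  proof -
    obtain V :: "'b set" where V: "open V" "convex V" "0 \<in> V" "V \<subseteq> ball 0 (inverse (Suc n))"
      using convex_neighbourhood[of "inverse (Suc n)"] by auto
    define A where "A = (\<lambda>i. fst ` ((UNIV \<times> {z. z - d i \<in> V}) \<inter> G n))"
    have A_iff: "x \<in> A i \<longleftrightarrow> (\<exists>y\<in>slice (G n) x. y - d i \<in> V)" for x i
    proof
      assume "x \<in> A i"
      then show "\<exists>y\<in>slice (G n) x. y - d i \<in> V"
        by (auto simp: A_def slice_def)
    next
      assume "\<exists>y\<in>slice (G n) x. y - d i \<in> V"
      then obtain y where "(x, y) \<in> (UNIV \<times> {z. z - d i \<in> V}) \<inter> G n"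
        by (auto simp: slice_def)
      from imageI[OF this, of fst] show "x \<in> A i"
        by (simp add: A_def)
    qed
    have A: "Sigma_class r (A i)" for i
      unfolding A_def using V(1) by (intro proj open_diff_vimage)
    \<comment> \<open>\<open>f x\<close> is in the slice, and by density some \<open>d i\<close> is
      close to it.\<close>
    have A_cover: "(\<Union>i. A i) = UNIV"
    proof -
      have "\<exists>i. f x - d i \<in> V" for x
      proof -
        define S where "S = {z. f x - z \<in> V}"
        have S: "open S" "f x \<in> S"
          using V by (simp_all add: S_def open_diff_vimage)
        then have "S \<inter> range d \<noteq> {}"
          using open_Int_closure_eq_empty[OF S(1), of "range d"] d by auto
        then show ?thesis
          by (auto simp: S_def)
      qed
      then have "\<exists>i. x \<in> A i" for x
        using f unfolding A_iff by blast
      then show ?thesis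
        by auto
    qed
    obtain h where h: "Baire_class p h" "\<And>x. h x \<in> convex hull {d i |i. x \<in> A i}"
      by (rule Sigma_cover_selection[OF p A A_cover, of d]) (assumption | rule that)+
    have "\<exists>y\<in>slice (G n) x. dist (h x) y < inverse (Suc n)" for x
    proof -
      \<comment> \<open>The slice minus \<open>V\<close> is a difference of convex sets, hence
        convex, and it contains every \<open>d i\<close> with \<open>x \<in> A i\<close>.\<close>
      have "convex hull {d i |i. x \<in> A i} \<subseteq> (\<Union>y\<in>slice (G n) x. \<Union>v\<in>V. {y - v})"
      proof (intro hull_minimal convex_differences convex V(2) subsetI)
        fix z assume "z \<in> {d i |i. x \<in> A i}"
        then obtain i y where "z = d i" "y \<in> slice (G n) x" "y - d i \<in> V"
          by (auto simp: A_iff)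
        then show "z \<in> (\<Union>y\<in>slice (G n) x. \<Union>v\<in>V. {y - v})"
          by (intro UN_I[of y] UN_I[of "y - d i"]) auto
      qed
      then obtain y v where y: "y \<in> slice (G n) x" "v \<in> V" "h x = y - v"
        using h(2)[of x] by blast
      have "dist (h x) y = dist 0 v"
        using dist_diff[of "h x" y] y(3) by simp
      then show ?thesis
        using y V(4) by (intro bexI[of _ y]) auto
    qed
    then show ?thesis
      using h(1) by auto
  qed
  then obtain h where h: "\<And>n. Baire_class p (h n)"
    "\<And>n x. \<exists>y\<in>slice (G n) x. dist (h n x) y < inverse (Suc n)"
    by metis
  show ?thesis
  proof (rule Baire_class_limI)
    show "one_ord \<le>o r"
      using proj[OF open_UNIV] by (rule Sigma_class_ge_one)
    show "\<exists>s. s <o r \<and> Baire_class s (h n)" for n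
      using p(1) h(1) by auto
    show "(\<lambda>n. h n x) \<longlonglongrightarrow> f x" for x
    \<comment> \<open>\<open>h n x\<close> is within 1/(n+1) of a point that shares the slice of
      \<open>G n\<close> with \<open>f x\<close>.\<close>
    proof (rule metric_tendsto_imp_tendsto)
      show "(\<lambda>n. inverse (real (Suc n)) + diameter (slice (G n) x)) \<longlonglongrightarrow> 0"
        using tendsto_add[OF LIMSEQ_inverse_real_of_nat diam[of x]] by simp
      show "\<forall>\<^sub>F n in sequentially. dist (h n x) (f x) \<le> dist (inverse (real (Suc n)) + diameter (slice (G n) x)) 0"
        using bounded[of x]
      proof eventually_elim
        case (elim n)
        obtain y where y: "y \<in> slice (G n) x" "dist (h n x) y < inverse (Suc n)"
          using h(2) by blast
        have "dist y (f x) \<le> diameter (slice (G n) x)"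
          using diameter_bounded_bound[OF elim y(1) f] .
        then have "dist (h n x) (f x) \<le> inverse (real (Suc n)) + diameter (slice (G n) x)"
          using y(2) dist_triangle[of "h n x" "f x" y] by linarith
        then show ?case
          unfolding dist_real_def by linarith
      qed
    qed
  qed
qed

end

theorem theorem1p7:
  fixes g :: "'p::polish_space \<Rightarrow> 'a::metric_space"
    and f :: "'a \<Rightarrow> 'b::{real_vector,metric_space}"
    and \<alpha> :: "nat rel"
  assumes suslin: "continuous_on UNIV g" "surj g"
    and Y: "separable_Frechet TYPE('b)"
    and alpha: "successor_ordinal \<alpha>"
  shows "Baire_class \<alpha> f \<longleftrightarrow>
    (\<exists>G :: nat \<Rightarrow> ('a \<times> 'b) set.
       (\<forall>n. Sigma_strip \<alpha> (G n)) \<and>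
       (\<forall>n. G (Suc n) \<subseteq> G n) \<and>
       (\<Inter>n. G n) = graph f \<and>
       (\<forall>x. (\<forall>\<^sub>F n in sequentially. bounded (slice (G n) x)) \<and>
            (\<lambda>n. diameter (slice (G n) x)) \<longlonglongrightarrow> 0) \<and>
       (\<forall>n U. open U \<longrightarrow> Sigma_class \<alpha> (fst ` ((UNIV \<times> U) \<inter> G n))))"
  (is "_ \<longleftrightarrow> ?strips")
proof
  interpret Frechet "TYPE('b)"
    using Y by unfold_locales
  have "one_ord \<le>o \<alpha>"
    using alpha by (auto simp: one_ordLeq_iff successor_ordinal_def)
  then show "Baire_class \<alpha> f \<Longrightarrow> ?strips"
    by (rule Baire_class_imp_strips)
  obtain p :: "nat rel" where p: "p <o \<alpha>" "\<And>s :: nat rel. s <o \<alpha> \<Longrightarrow> s \<le>o p"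
    using successor_ordinal_pred[OF alpha] by metis
  assume ?strips
  then obtain G :: "nat \<Rightarrow> ('a \<times> 'b) set" where G: "\<And>n. Sigma_strip \<alpha> (G n)"
      "(\<Inter>n. G n) = graph f"
      "\<And>x. (\<forall>\<^sub>F n in sequentially. bounded (slice (G n) x))"
      "\<And>x. (\<lambda>n. diameter (slice (G n) x)) \<longlonglongrightarrow> 0"
      "\<And>n U. open U \<Longrightarrow> Sigma_class \<alpha> (fst ` ((UNIV \<times> U) \<inter> G n))"
    by metis
  show "Baire_class \<alpha> f"
  proof (rule strips_imp_Baire_class[OF p])
    show "convex (slice (G n) x)" for n x
      using G(1) by (simp add: Sigma_strip_def)
    show "f x \<in> slice (G n) x" for n x
      using G(2) by (auto simp: graph_def slice_def)
  qed (use G(3-5) in auto)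
qed

end
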